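(* Let $A$ be a commutative ring, $I$ a set, $G$ a commutative group, $\psi\colon\mathbb{Z}^{\oplus I}\twoheadrightarrow G$ an epimorphism of groups, and let $R=A[(X_i)_{i\in I}]$ be the polynomial algebra, furnished with the $G$-graduation derived from its canonical $\mathbb{Z}^{\oplus I}$-graduation by means of $\psi$. a) For every monomial ideal $\mathfrak{a}\subseteq R$ of finite type we have $\Gamma_{\mathfrak{a}}=\Gamma_{\lfloor\mathfrak{a}\rfloor}$. b) If $\mathfrak{a},\mathfrak{b}\subseteq R$ are monomial ideals of finite type, then the following statements are equivalent: (i) $\Gamma_{\mathfrak{a}}=\Gamma_{\mathfrak{b}}$; (ii) $\lfloor\mathfrak{a}\rfloor=\lfloor\mathfrak{b}\rfloor$; (iii) $\sqrt{\mathfrak{a}}=\sqrt{\mathfrak{b}}$.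
   Context: Rings are commutative with unit and $\mathbb{N}$ contains $0$. A monomial in $R$ is an element of the form $\prod_{i\in I}X_i^{\mu_i}$ with $\mu=(\mu_i)_{i\in I}\in\mathbb{N}^{\oplus I}$; it is homogeneous of degree $\psi(\mu)\in G$. A monomial ideal of $R$ is an ideal generated by a set of monomials; monomial ideals are graded. "Of finite type" means finitely generated. For a monomial ideal $\mathfrak{a}\subseteq R$ there is a unique subset $E(\mathfrak{a})\subseteq\mathbb{N}^{\oplus I}$ such that $\{\prod_{i\in I}X_i^{\mu_i}\mid\mu\in E(\mathfrak{a})\}$ is a minimal generating set of $\mathfrak{a}$, and one defines the monomial ideal $\lfloor\mathfrak{a}\rfloor:=\langle\prod_{i\in I,\,\mu_i>0}X_i\mid\mu\in E(\mathfrak{a})\rangle_R$. For a graded ideal $\mathfrak{c}\subseteq R$, $\Gamma_{\mathfrak{c}}$ denotes the $G$-graded $\mathfrak{c}$-torsion functor, i.e. the subfunctor of the identity functor on the category of $G$-graded $R$-modules with $\Gamma_{\mathfrak{c}}(M)=\bigcup_{n\in\mathbb{N}}(0:_M\mathfrak{c}^n)$ for every $G$-graded $R$-module $M$. Equality of such functors is equality as subfunctors of the identity, i.e. equality of the submodules for every $G$-graded $R$-module $M$. *)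

theory Defs
  imports "HOL-Algebra.Algebra" "HOL-Library.Poly_Mapping" "HOL-Library.Equipollence"
begin

section \<open>Polynomial rings in an arbitrary set of variables\<close>

text \<open>
  An exponent is a finitely supported function \<open>'i \<Rightarrow>\<^sub>0 nat\<close> whose support lies in \<open>I\<close>; a
  polynomial is the function assigning to each exponent its coefficient. The coefficient ring is a
  record rather than a type of class \<open>comm_ring_1\<close>, and the variables form a set rather than a
  type, so that the zero ring and the empty set of variables are included.
\<close>

definition exponents :: "'i set \<Rightarrow> ('i \<Rightarrow>\<^sub>0 nat) set"
  where "exponents I = {\<mu>. Poly_Mapping.keys \<mu> \<subseteq> I}"

definition mpoly_monom :: "('a, 'k) ring_scheme \<Rightarrow> ('i \<Rightarrow>\<^sub>0 nat) \<Rightarrow> (('i \<Rightarrow>\<^sub>0 nat) \<Rightarrow> 'a)"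
  where "mpoly_monom A \<mu> = (\<lambda>\<nu>. if \<nu> = \<mu> then \<one>\<^bsub>A\<^esub> else \<zero>\<^bsub>A\<^esub>)"

definition mpoly_ring :: "('a, 'k) ring_scheme \<Rightarrow> 'i set \<Rightarrow> (('i \<Rightarrow>\<^sub>0 nat) \<Rightarrow> 'a) ring"
  where "mpoly_ring A I =
    \<lparr> carrier = {p. (\<forall>\<mu>. p \<mu> \<in> carrier A) \<and> finite {\<mu>. p \<mu> \<noteq> \<zero>\<^bsub>A\<^esub>} \<and>
                    {\<mu>. p \<mu> \<noteq> \<zero>\<^bsub>A\<^esub>} \<subseteq> exponents I},
      monoid.mult = (\<lambda>p q \<mu>. \<Oplus>\<^bsub>A\<^esub>x \<in> {(\<alpha>, \<beta>). \<alpha> + \<beta> = \<mu>}. p (fst x) \<otimes>\<^bsub>A\<^esub> q (snd x)),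
      monoid.one = mpoly_monom A 0,
      ring.zero = (\<lambda>\<mu>. \<zero>\<^bsub>A\<^esub>),
      ring.add = (\<lambda>p q \<mu>. p \<mu> \<oplus>\<^bsub>A\<^esub> q \<mu>) \<rparr>"

text \<open>
  The component of degree \<open>g\<close> of the grading obtained by coarsening the canonical grading along
  \<open>\<psi>\<close>; the map \<open>int\<close> turns an exponent into an element of the free abelian group.
\<close>

definition mpoly_grading ::
    "('a, 'k) ring_scheme \<Rightarrow> 'i set \<Rightarrow> (('i \<Rightarrow>\<^sub>0 int) \<Rightarrow> 'g) \<Rightarrow> 'g \<Rightarrow> (('i \<Rightarrow>\<^sub>0 nat) \<Rightarrow> 'a) set"
  where "mpoly_grading A I \<psi> g =
    {p \<in> carrier (mpoly_ring A I). \<forall>\<mu>. p \<mu> \<noteq> \<zero>\<^bsub>A\<^esub> \<longrightarrow> \<psi> (Poly_Mapping.map int \<mu>) = g}"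


section \<open>Ideals\<close>

definition finite_type_ideal :: "('r, 'k) ring_scheme \<Rightarrow> 'r set \<Rightarrow> bool"
  where "finite_type_ideal R \<aa> \<longleftrightarrow> (\<exists>F. finite F \<and> F \<subseteq> carrier R \<and> \<aa> = genideal R F)"

definition radical :: "('r, 'k) ring_scheme \<Rightarrow> 'r set \<Rightarrow> 'r set"
  where "radical R \<aa> = {x \<in> carrier R. \<exists>n::nat. x [^]\<^bsub>R\<^esub> n \<in> \<aa>}"

definition monomial_ideal ::
    "('a, 'k) ring_scheme \<Rightarrow> 'i set \<Rightarrow> (('i \<Rightarrow>\<^sub>0 nat) \<Rightarrow> 'a) set \<Rightarrow> bool"
  where "monomial_ideal A I \<aa> \<longleftrightarrow>
    (\<exists>S \<subseteq> exponents I. \<aa> = genideal (mpoly_ring A I) (mpoly_monom A ` S))"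

text \<open>
  Minimality refers to the set of monomials and not to the set of exponents. The two differ only
  over the zero ring, where \<open>{0}\<close> is not a minimal generating set and the empty set of exponents
  is thus the only one with the property below.
\<close>

definition min_monomial_generators ::
    "('a, 'k) ring_scheme \<Rightarrow> 'i set \<Rightarrow> (('i \<Rightarrow>\<^sub>0 nat) \<Rightarrow> 'a) set \<Rightarrow> ('i \<Rightarrow>\<^sub>0 nat) set \<Rightarrow> bool"
  where "min_monomial_generators A I \<aa> E \<longleftrightarrow>
    E \<subseteq> exponents I \<and> genideal (mpoly_ring A I) (mpoly_monom A ` E) = \<aa> \<and>
    (\<forall>S. S \<subset> mpoly_monom A ` E \<longrightarrow> genideal (mpoly_ring A I) S \<noteq> \<aa>)"

definition min_exponents ::
    "('a, 'k) ring_scheme \<Rightarrow> 'i set \<Rightarrow> (('i \<Rightarrow>\<^sub>0 nat) \<Rightarrow> 'a) set \<Rightarrow> ('i \<Rightarrow>\<^sub>0 nat) set"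
  where "min_exponents A I \<aa> = (THE E. min_monomial_generators A I \<aa> E)"

text \<open>
  \<open>Poly_Mapping.map (\<lambda>_. 1) \<mu>\<close> is 1 on the support of \<open>\<mu>\<close> and 0 elsewhere, because
  \<open>Poly_Mapping.map\<close> always keeps zero values.
\<close>

definition floor_ideal ::
    "('a, 'k) ring_scheme \<Rightarrow> 'i set \<Rightarrow> (('i \<Rightarrow>\<^sub>0 nat) \<Rightarrow> 'a) set \<Rightarrow> (('i \<Rightarrow>\<^sub>0 nat) \<Rightarrow> 'a) set"
  where "floor_ideal A I \<aa> =
    genideal (mpoly_ring A I)
      ((\<lambda>\<mu>. mpoly_monom A (Poly_Mapping.map (\<lambda>_. 1) \<mu>)) ` min_exponents A I \<aa>)"


section \<open>Graded modules and torsion functors\<close>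

locale graded_module = module R M
  for G :: "('g, 'h) monoid_scheme"
    and R :: "('r, 'k) ring_scheme" and Rgr :: "'g \<Rightarrow> 'r set"
    and M :: "('r, 'm, 'l) module_scheme" and Mgr :: "'g \<Rightarrow> 'm set" +
  assumes component_subgroup: "g \<in> carrier G \<Longrightarrow> additive_subgroup (Mgr g) M"
    and direct_sum: "x \<in> carrier M \<Longrightarrow>
      \<exists>!f. (\<forall>g \<in> carrier G. f g \<in> Mgr g) \<and> (\<forall>g. g \<notin> carrier G \<longrightarrow> f g = \<zero>\<^bsub>M\<^esub>) \<and>
           finite {g. f g \<noteq> \<zero>\<^bsub>M\<^esub>} \<and> x = (\<Oplus>\<^bsub>M\<^esub>g \<in> {g. f g \<noteq> \<zero>\<^bsub>M\<^esub>}. f g)"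
    and smult_degree: "\<lbrakk> g \<in> carrier G; h \<in> carrier G; r \<in> Rgr g; x \<in> Mgr h \<rbrakk> \<Longrightarrow>
      r \<odot>\<^bsub>M\<^esub> x \<in> Mgr (g \<otimes>\<^bsub>G\<^esub> h)"

definition annihilated :: "('r, 'm, 'l) module_scheme \<Rightarrow> 'r set \<Rightarrow> 'm set"
  where "annihilated M \<cc> = {x \<in> carrier M. \<forall>r \<in> \<cc>. r \<odot>\<^bsub>M\<^esub> x = \<zero>\<^bsub>M\<^esub>}"

text \<open>
  Powers are taken in the multiplicative monoid of ideals, so \<open>\<cc>\<^sup>0\<close> is the whole ring.
\<close>

definition torsion :: "('r, 'k) ring_scheme \<Rightarrow> 'r set \<Rightarrow> ('r, 'm, 'l) module_scheme \<Rightarrow> 'm set"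
  where "torsion R \<cc> M = (\<Union>n::nat. annihilated M (\<cc> [^]\<^bsub>ideals_set R\<^esub> n))"

text \<open>
  Equality of the graded torsion functors as subfunctors of the identity. A quantifier over all
  modules has to fix the type of their elements; this type \<open>'m\<close> plays the role of a universe. The
  grading of a graded submodule is induced, so that it suffices to compare underlying submodules.
\<close>

definition torsion_functors_eq ::
    "'m itself \<Rightarrow> ('g, 'h) monoid_scheme \<Rightarrow> ('r, 'k) ring_scheme \<Rightarrow> ('g \<Rightarrow> 'r set) \<Rightarrow>
      'r set \<Rightarrow> 'r set \<Rightarrow> bool"
  where "torsion_functors_eq (T :: 'm itself) G R Rgr \<cc> \<dd> \<longleftrightarrow>
    (\<forall>(M :: ('r, 'm) module) Mgr. graded_module G R Rgr M Mgr \<longrightarrow> torsion R \<cc> M = torsion R \<dd> M)"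

end

theory Submission
  imports Defs
begin

text \<open>
  For finitely generated ideals the torsion functor depends only on the radical: if every generator
  of \<open>\<aa>\<close> has a power in \<open>\<bb>\<close>, then some power of \<open>\<aa>\<close> lies in \<open>\<bb>\<close>. A monomial ideal consists of the
  polynomials whose exponents all lie in an upward closed set, and its minimal generators are the
  minimal elements of that set. A large power of the squarefree part of a monomial is a multiple of
  the monomial, so \<open>\<aa>\<close> and its floor have the same radical; conversely the floor can be read off from
  the supports of the monomials in the radical. Finally, \<open>R/\<aa>\<close> is \<open>\<aa>\<close>-torsion, and it is \<open>\<bb>\<close>-torsion
  only if some power of \<open>\<bb>\<close> lies in \<open>\<aa>\<close>, so that the torsion functor determines the radical.
\<close>

section \<open>Powers and radicals of finitely generated ideals\<close>

text \<open>Radicals speak of powers of elements, torsion of powers of ideals; finite type is what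
  passes from the former to the latter. The set \<open>I\<close> may be infinite, so Dickson's lemma
  fails and an upward closed set of exponents can have infinitely many minimal elements. That they
  exist, with one below every member, comes from descent: a monomial has only finitely many
  divisors. Finite type then makes their number finite. Over the zero ring all monomials coincide,
  so exponents cannot be recovered from an ideal; that case is split off, every ideal there being
  zero. For the converse, the quotient module must have elements of the prescribed type
  \<open>'m\<close>. Cosets do not provide this, but a monomial ideal is spanned by monomials, so
  every class has a canonical representative, namely the polynomial without terms in the ideal.
  Representatives are polynomials and can be moved along an injection, and their grading is read off
  coefficient by coefficient.\<close>

context cring
begin

lemma ideal_power_is_ideal:
  assumes "ideal J R"
  shows "ideal (J [^]\<^bsub>ideals_set R\<^esub> (n::nat)) R"
proof -
  interpret S: comm_monoid "ideals_set R"
    by (rule ideals_set_is_comm_monoid)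
  have "J [^]\<^bsub>ideals_set R\<^esub> n \<in> carrier (ideals_set R)"
    using assms by (intro S.nat_pow_closed) (simp add: ideals_set_def)
  then show ?thesis
    by (simp add: ideals_set_def)
qed

lemma ideal_power_0: "J [^]\<^bsub>ideals_set R\<^esub> (0::nat) = carrier R"
  by (simp add: nat_pow_def ideals_set_def)

lemma ideal_power_Suc: "J [^]\<^bsub>ideals_set R\<^esub> Suc n = (J [^]\<^bsub>ideals_set R\<^esub> n) \<cdot> J"
  by (simp add: nat_pow_def ideals_set_def)

lemma ideal_power_1:
  assumes "ideal J R"
  shows "J [^]\<^bsub>ideals_set R\<^esub> Suc 0 = J"
  using ideal_prod_one[OF assms] ideal_prod_commute[OF assms oneideal]
  by (simp only: ideal_power_Suc ideal_power_0)

lemma nat_pow_in_ideal_power: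
  assumes "x \<in> J"
    and "ideal J R"
  shows "x [^] n \<in> J [^]\<^bsub>ideals_set R\<^esub> (n::nat)"
proof (induction n)
  case 0
  then show ?case by (simp only: ideal_power_0 nat_pow_0 one_closed)
next
  case (Suc n)
  then show ?case
    using assms ideal_prod.prod[of "x [^] n" "J [^]\<^bsub>ideals_set R\<^esub> n" x J R]
    by (subst ideal_power_Suc) simp
qed

lemma ideal_prod_subsetI:
  assumes "ideal B R"
    and "\<And>j k. \<lbrakk>j \<in> J; k \<in> K\<rbrakk> \<Longrightarrow> j \<otimes> k \<in> B"
  shows "J \<cdot> K \<subseteq> B"
proof
  fix s assume "s \<in> J \<cdot> K"
  then show "s \<in> B"
  proof (induction s rule: ideal_prod.induct)
    case (prod i j)
    then show ?case using assms(2) by blast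
  next
    case (sum s1 s2)
    then show ?case using assms(1) by (simp add: additive_subgroup.a_closed ideal.axioms(1))
  qed
qed

text \<open>The colon ideal \<open>(B : J)\<close>. The next induction uses it with a single
  generator and with a power of the generated ideal in place of \<open>J\<close>.\<close>

lemma colon_ideal:
  assumes "ideal B R"
    and "J \<subseteq> carrier R"
  shows "ideal {r \<in> carrier R. \<forall>j \<in> J. j \<otimes> r \<in> B} R"
proof -
  interpret B: ideal B R by fact
  have J: "j \<in> carrier R" if "j \<in> J" for j using assms that by blast
  have z: "j \<otimes> \<ominus> r \<in> B" if "j \<otimes> r \<in> B" "j \<in> J" "r \<in> carrier R" for j r
    using that J B.a_inv_closed by (simp add: r_minus)
  show ?thesis
  proof (intro idealI ring_axioms)
    show "subgroup {r \<in> carrier R. \<forall>j \<in> J. j \<otimes> r \<in> B} (add_monoid R)"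
      by (rule add.subgroupI) (use J z in \<open>auto simp: r_distr a_inv_def[symmetric]\<close>)
  next
    fix a x
    assume a: "a \<in> {r \<in> carrier R. \<forall>j \<in> J. j \<otimes> r \<in> B}" and x: "x \<in> carrier R"
    have "j \<otimes> (a \<otimes> x) \<in> B" if "j \<in> J" for j
      using B.I_r_closed[of "j \<otimes> a" x] a x that J by (simp add: m_assoc)
    then show "a \<otimes> x \<in> {r \<in> carrier R. \<forall>j \<in> J. j \<otimes> r \<in> B}" "x \<otimes> a \<in> {r \<in> carrier R. \<forall>j \<in> J. j \<otimes> r \<in> B}"
      using a x by (auto simp: m_comm)
  qed
qed

text \<open>A product of more than \<open>sum n F\<close> generators contains some \<open>f\<close>
  at least \<open>n f\<close> times and hence lies in \<open>B\<close>. The induction reaches this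
  without expanding powers of the ideal into products of generators. The \<open>Suc\<close> matters
  for empty \<open>F\<close>: the zeroth power would be the whole ring.\<close>

lemma genideal_power_subset:
  fixes n :: "'a \<Rightarrow> nat"
  assumes "finite F"
    and "F \<subseteq> carrier R"
    and "ideal B R"
    and "\<And>f. f \<in> F \<Longrightarrow> f [^] n f \<in> B"
  shows "(Idl F) [^]\<^bsub>ideals_set R\<^esub> Suc (\<Sum>f\<in>F. n f) \<subseteq> B"
  using assms(3,4)
proof (induction "\<Sum>f\<in>F. n f" arbitrary: B n rule: less_induct)
  case less
  \<comment> \<open>For \<open>f \<in> F\<close> the colon ideal \<open>(B : f)\<close> contains \<open>f\<close> to a smaller power, so it contains \<open>?J\<close>.\<close>
  let ?J = "(Idl F) [^]\<^bsub>ideals_set R\<^esub> (\<Sum>f\<in>F. n f)"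
  have IF: "ideal (Idl F) R"
    using assms(2) by (rule genideal_ideal)
  have J: "ideal ?J R"
    using IF by (rule ideal_power_is_ideal)
  then have Jcarr: "?J \<subseteq> carrier R"
    by (auto dest: ideal.Icarr)
  show ?case
  proof (cases "\<exists>f\<in>F. n f = 0")
    case True
    then have "\<one> \<in> B"
      using less.prems(2) by force
    then have "B = carrier R"
      by (rule ideal.one_imp_carrier[OF less.prems(1)])
    then show ?thesis
      using ideal.Icarr[OF ideal_power_is_ideal[OF IF]] by (blast intro: subsetI)
  next
    case False
    have "j \<otimes> f \<in> B" if f: "f \<in> F" and j: "j \<in> ?J" for f j
    proof -
      obtain k where k: "n f = Suc k"
        using False f not0_implies_Suc by blast
      let ?n = "n(f := k)"
      have fc: "f \<in> carrier R" using f assms(2) by blast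
      let ?B = "{r \<in> carrier R. \<forall>g \<in> {f}. g \<otimes> r \<in> B}"
      have B: "ideal ?B R"
        by (rule colon_ideal) (use less.prems fc in auto)
      have sums: "sum n F = n f + sum n (F - {f})" "sum ?n F = k + sum ?n (F - {f})"
        using f assms(1) by (simp_all add: sum.remove)
      have "sum ?n (F - {f}) = sum n (F - {f})"
        by (rule sum.cong) auto
      then have s: "sum n F = Suc (sum ?n F)"
        using sums k by simp
      have "g [^] ?n g \<in> ?B" if "g \<in> F" for g
      proof -
        have g: "g \<in> carrier R" using that assms(2) by blast
        have "f \<otimes> g [^] ?n g \<in> B"
        proof (cases "g = f")
          case True
          then show ?thesis
            using less.prems(2)[OF f] k fc by (simp add: m_comm)
        next
          case False
          then show ?thesis
            using less.prems(2)[OF that] fc ideal.I_l_closed[OF less.prems(1)] by simp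
        qed
        then show ?thesis using g by simp
      qed
      \<comment> \<open>By \<open>s\<close> the power on the left is \<open>?J\<close>: lowering
        \<open>n f\<close> by one saves exactly the factor that multiplication by \<open>f\<close>
        contributes.\<close>
      then have "(Idl F) [^]\<^bsub>ideals_set R\<^esub> Suc (sum ?n F) \<subseteq> ?B"
        using less.hyps[OF _ B] s by simp
      then have "f \<otimes> j \<in> B"
        using j s by auto
      then show ?thesis
        using fc j Jcarr by (simp add: m_comm subset_iff)
    qed
    \<comment> \<open>The same products seen from the other side: each generator lies in
      \<open>(B : ?J)\<close>, and since this is an ideal it contains \<open>Idl F\<close>.\<close>
    then have "F \<subseteq> {r \<in> carrier R. \<forall>j\<in>?J. j \<otimes> r \<in> B}"
      using assms(2) by auto
    then have "Idl F \<subseteq> {r \<in> carrier R. \<forall>j\<in>?J. j \<otimes> r \<in> B}"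
      by (intro genideal_minimal colon_ideal less.prems Jcarr)
    then show ?thesis
      unfolding ideal_power_Suc by (intro ideal_prod_subsetI less.prems) auto
  qed
qed

lemma genideal_power_subset_radical:
  assumes "finite F"
    and "F \<subseteq> carrier R"
    and "ideal B R"
    and "F \<subseteq> radical R B"
  obtains N where "(Idl F) [^]\<^bsub>ideals_set R\<^esub> (N::nat) \<subseteq> B"
proof -
  have "\<forall>f\<in>F. \<exists>n::nat. f [^] n \<in> B"
    using assms(4) by (auto simp: radical_def)
  then obtain n :: "'a \<Rightarrow> nat" where "\<And>f. f \<in> F \<Longrightarrow> f [^] n f \<in> B"
    by metis
  from genideal_power_subset[OF assms(1-3) this] show thesis
    using that by blast
qed

lemma finite_type_power_subset:
  assumes "finite_type_ideal R J"
    and "ideal B R"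
    and "J \<subseteq> radical R B"
  obtains N where "J [^]\<^bsub>ideals_set R\<^esub> (N::nat) \<subseteq> B"
proof -
  obtain F where F: "finite F" "F \<subseteq> carrier R" "J = Idl F"
    using assms(1) by (auto simp: finite_type_ideal_def)
  then have "F \<subseteq> radical R B"
    using genideal_self assms(3) by blast
  from genideal_power_subset_radical[OF F(1,2) assms(2) this] show thesis
    using that F(3) by blast
qed

lemma finite_type_ideal_is_ideal:
  assumes "finite_type_ideal R J"
  shows "ideal J R"
  using assms genideal_ideal by (auto simp: finite_type_ideal_def)

text \<open>Torsion for \<open>B\<close> runs over all powers of \<open>B\<close>, so a power of
  \<open>J\<close> is wanted inside each of them. An exponent \<open>k\<close> that works for
  \<open>B\<close> becomes \<open>k * n\<close> for the power \<open>n\<close>.\<close>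

lemma radical_ideal_power:
  assumes "ideal B R"
  shows "radical R B \<subseteq> radical R (B [^]\<^bsub>ideals_set R\<^esub> (n::nat))"
proof
  fix x assume "x \<in> radical R B"
  then obtain k :: nat where "x \<in> carrier R" "x [^] k \<in> B"
    by (auto simp: radical_def)
  then have "x [^] (k * n) \<in> B [^]\<^bsub>ideals_set R\<^esub> n"
    using nat_pow_in_ideal_power[OF _ assms] by (simp flip: nat_pow_pow)
  then show "x \<in> radical R (B [^]\<^bsub>ideals_set R\<^esub> n)"
    using \<open>x \<in> carrier R\<close> by (auto simp: radical_def)
qed

text \<open>Smaller ideals annihilate more: what a power of \<open>B\<close> kills is killed by the
  power of \<open>J\<close> inside it.\<close>

lemma torsion_antimono_radical:
  assumes "finite_type_ideal R J"
    and "ideal B R"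
    and "J \<subseteq> radical R B"
  shows "torsion R B M \<subseteq> torsion R J M"
proof -
  have "annihilated M (B [^]\<^bsub>ideals_set R\<^esub> n) \<subseteq> torsion R J M" for n :: nat
  proof -
    obtain N :: nat where "J [^]\<^bsub>ideals_set R\<^esub> N \<subseteq> B [^]\<^bsub>ideals_set R\<^esub> n"
      using finite_type_power_subset[OF assms(1) ideal_power_is_ideal[OF assms(2)]]
        assms(3) radical_ideal_power[OF assms(2)] by blast
    then show ?thesis
      unfolding torsion_def annihilated_def by blast
  qed
  then show ?thesis
    unfolding torsion_def[of R B] by blast
qed

lemma radical_mono_radical:
  assumes "finite_type_ideal R J"
    and "ideal B R"
    and "J \<subseteq> radical R B"
  shows "radical R J \<subseteq> radical R B"
proof
  fix x assume "x \<in> radical R J"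
  then obtain k :: nat where k: "x \<in> carrier R" "x [^] k \<in> J"
    by (auto simp: radical_def)
  obtain N :: nat where "J [^]\<^bsub>ideals_set R\<^esub> N \<subseteq> B"
    using finite_type_power_subset[OF assms] by blast
  then have "x [^] (k * N) \<in> B"
    using nat_pow_in_ideal_power[OF k(2) finite_type_ideal_is_ideal[OF assms(1)], of N] k(1)
    by (auto simp: nat_pow_pow)
  then show "x \<in> radical R B"
    using k(1) by (auto simp: radical_def)
qed

text \<open>Stands in for the closure of the radical under sums: if a power \<open>N\<close> of the
  generated ideal lies in \<open>B\<close>, so does the power \<open>N\<close> of each of its
  elements. It reduces the inclusion of the floor in the radical to the generators of the
  floor.\<close>

lemma genideal_subset_radical:
  assumes "finite F"
    and "F \<subseteq> carrier R"
    and "ideal B R"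
    and "F \<subseteq> radical R B"
  shows "Idl F \<subseteq> radical R B"
proof
  fix x assume x: "x \<in> Idl F"
  have IF: "ideal (Idl F) R"
    using assms(2) by (rule genideal_ideal)
  obtain N :: nat where "(Idl F) [^]\<^bsub>ideals_set R\<^esub> N \<subseteq> B"
    using genideal_power_subset_radical[OF assms] .
  then have "x [^] N \<in> B"
    using nat_pow_in_ideal_power[OF x IF, of N] by blast
  then show "x \<in> radical R B"
    using ideal.Icarr[OF IF x] by (auto simp: radical_def)
qed

lemma ideal_subset_radical:
  assumes "ideal J R"
  shows "J \<subseteq> radical R J"
proof
  fix x assume "x \<in> J"
  then have "x \<in> carrier R" "x [^] (1::nat) \<in> J"
    using ideal.Icarr[OF assms] by auto
  then show "x \<in> radical R J" unfolding radical_def by blast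
qed

lemma torsion_cong_radical:
  assumes "finite_type_ideal R J"
    and "finite_type_ideal R K"
    and "radical R J = radical R K"
  shows "torsion R J M = torsion R K M"
proof -
  have "ideal J R" "ideal K R"
    using assms finite_type_ideal_is_ideal by auto
  moreover from this have "J \<subseteq> radical R K" "K \<subseteq> radical R J"
    using ideal_subset_radical assms(3) by auto
  ultimately show ?thesis
    using assms(1,2) by (intro subset_antisym torsion_antimono_radical)
qed

end

section \<open>The polynomial ring\<close>

lemma lookup_map_int [simp]: "Poly_Mapping.lookup (Poly_Mapping.map int \<mu>) i = int (Poly_Mapping.lookup \<mu> i)"
  by (simp add: Poly_Mapping.map.rep_eq when_def)

text \<open>Such exponents vanish off the finite support of \<open>\<mu>\<close> and are bounded on
  it. This makes the convolution sums finite and supplies the measure for the descent to minimal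
  exponents, also for infinitely many variables.\<close>

lemma finite_exponents_le: "finite {\<nu> :: 'i \<Rightarrow>\<^sub>0 nat. \<forall>i. Poly_Mapping.lookup \<nu> i \<le> Poly_Mapping.lookup \<mu> i}"
proof -
  \<comment> \<open>\<open>finite_set_of_finite_funs\<close> takes one range for all arguments; the
    sum of all values is a common bound that also makes sense for \<open>\<mu> = 0\<close>.\<close>
  let ?S = "{f. \<forall>i. (i \<in> Poly_Mapping.keys \<mu> \<longrightarrow> f i \<in> {..\<Sum>i\<in>Poly_Mapping.keys \<mu>. Poly_Mapping.lookup \<mu> i}) \<and> (i \<notin> Poly_Mapping.keys \<mu> \<longrightarrow> f i = (0::nat))}"
  have "finite ?S"
    by (rule finite_set_of_finite_funs) auto
  moreover have "Poly_Mapping.lookup ` {\<nu> :: 'i \<Rightarrow>\<^sub>0 nat. \<forall>i. Poly_Mapping.lookup \<nu> i \<le> Poly_Mapping.lookup \<mu> i} \<subseteq> ?S"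
  proof (rule image_subsetI, rule CollectI, intro allI conjI impI)
    fix \<nu> :: "'i \<Rightarrow>\<^sub>0 nat" and i
    assume \<nu>: "\<nu> \<in> {\<nu>. \<forall>i. Poly_Mapping.lookup \<nu> i \<le> Poly_Mapping.lookup \<mu> i}"
    show "Poly_Mapping.lookup \<nu> i \<in> {..\<Sum>i\<in>Poly_Mapping.keys \<mu>. Poly_Mapping.lookup \<mu> i}" if "i \<in> Poly_Mapping.keys \<mu>"
    proof -
      have "Poly_Mapping.lookup \<nu> i \<le> Poly_Mapping.lookup \<mu> i" using \<nu> by simp
      also have "\<dots> \<le> (\<Sum>i\<in>Poly_Mapping.keys \<mu>. Poly_Mapping.lookup \<mu> i)"
        using that by (intro member_le_sum) auto
      finally show ?thesis by simp
    qed
    show "Poly_Mapping.lookup \<nu> i = 0" if "i \<notin> Poly_Mapping.keys \<mu>"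
      using \<nu> that by (simp add: in_keys_iff) (metis le_zero_eq)
  qed
  ultimately have "finite (Poly_Mapping.lookup ` {\<nu> :: 'i \<Rightarrow>\<^sub>0 nat. \<forall>i. Poly_Mapping.lookup \<nu> i \<le> Poly_Mapping.lookup \<mu> i})"
    by (rule finite_subset[rotated])
  then show ?thesis
    by (rule finite_imageD) (auto simp: inj_on_def poly_mapping.lookup_inject)
qed

lemma exponents_add_iff: "\<alpha> + \<beta> \<in> exponents I \<longleftrightarrow> \<alpha> \<in> exponents I \<and> \<beta> \<in> exponents I"
  by (auto simp: exponents_def in_keys_iff lookup_add subset_iff)

definition splits :: "('i \<Rightarrow>\<^sub>0 nat) \<Rightarrow> (('i \<Rightarrow>\<^sub>0 nat) \<times> ('i \<Rightarrow>\<^sub>0 nat)) set"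
  where "splits \<mu> = {(\<alpha>, \<beta>). \<alpha> + \<beta> = \<mu>}"

lemma in_splits [simp]: "(\<alpha>, \<beta>) \<in> splits \<mu> \<longleftrightarrow> \<alpha> + \<beta> = \<mu>"
  by (simp add: splits_def)

lemma finite_splits [simp]: "finite (splits \<mu>)"
proof -
  let ?D = "{\<nu>. \<forall>i. Poly_Mapping.lookup \<nu> i \<le> Poly_Mapping.lookup \<mu> i}"
  have "splits \<mu> \<subseteq> ?D \<times> ?D"
    by (auto simp: lookup_add)
  then show ?thesis
    using finite_exponents_le finite_subset by blast
qed

section \<open>Rearranging finite sums\<close>

lemma (in abelian_monoid) finsum_Sigma:
  assumes "finite B"
    and "\<And>x. x \<in> B \<Longrightarrow> finite (C x)"
    and "\<And>x y. \<lbrakk>x \<in> B; y \<in> C x\<rbrakk> \<Longrightarrow> f x y \<in> carrier G"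
  shows "(\<Oplus>x\<in>B. \<Oplus>y\<in>C x. f x y) = (\<Oplus>z\<in>Sigma B C. f (fst z) (snd z))"
proof -
  have "(\<Oplus>z\<in>(\<Union>x\<in>B. Pair x ` C x). f (fst z) (snd z))
      = (\<Oplus>x\<in>B. \<Oplus>z\<in>Pair x ` C x. f (fst z) (snd z))"
    using assms by (intro add.finprod_UN_disjoint) (auto simp: pairwise_def disjnt_def)
  also have "\<dots> = (\<Oplus>x\<in>B. \<Oplus>y\<in>C x. f x y)"
  proof (rule finsum_cong')
    fix x assume x: "x \<in> B"
    have "(\<Oplus>z\<in>Pair x ` C x. f (fst z) (snd z)) = (\<Oplus>y\<in>C x. f (fst (x, y)) (snd (x, y)))"
      using x assms(3) by (intro add.finprod_reindex) (auto simp: inj_on_def)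
    then show "(\<Oplus>z\<in>Pair x ` C x. f (fst z) (snd z)) = (\<Oplus>y\<in>C x. f x y)"
      by simp
  qed (use assms(3) in \<open>auto intro!: finsum_closed\<close>)
  also have "(\<Union>x\<in>B. Pair x ` C x) = Sigma B C"
    by auto
  finally show ?thesis by simp
qed

lemma (in abelian_monoid) finsum_bij:
  assumes "bij_betw h B C"
    and "\<And>x. x \<in> B \<Longrightarrow> f x = g (h x)"
    and "\<And>y. y \<in> C \<Longrightarrow> g y \<in> carrier G"
  shows "finsum G f B = finsum G g C"
proof -
  have "finsum G g C = finsum G g (h ` B)"
    using assms(1) by (simp add: bij_betw_def)
  also have "\<dots> = (\<Oplus>x\<in>B. g (h x))"
    using assms by (intro finsum_reindex) (auto simp: bij_betw_def)
  also have "\<dots> = finsum G f B"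
    using assms by (intro finsum_cong') (auto simp: bij_betw_def)
  finally show ?thesis by simp
qed

lemma (in abelian_monoid) finsum_single:
  assumes "finite B"
    and "a \<in> B"
    and "\<And>x. \<lbrakk>x \<in> B; x \<noteq> a\<rbrakk> \<Longrightarrow> f x = \<zero>"
    and "f a \<in> carrier G"
  shows "finsum G f B = f a"
proof -
  have "finsum G f B = finsum G f {a}"
    using assms by (intro add.finprod_mono_neutral_cong_right) (auto, metis zero_closed)
  then show ?thesis
    using assms(4) by simp
qed

lemma mpoly_carrier_iff:
  "p \<in> carrier (mpoly_ring A I) \<longleftrightarrow>
    (\<forall>\<mu>. p \<mu> \<in> carrier A) \<and> finite {\<mu>. p \<mu> \<noteq> \<zero>\<^bsub>A\<^esub>} \<and> (\<forall>\<mu>. p \<mu> \<noteq> \<zero>\<^bsub>A\<^esub> \<longrightarrow> \<mu> \<in> exponents I)"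
  by (auto simp: mpoly_ring_def)

lemma mpoly_add: "(p \<oplus>\<^bsub>mpoly_ring A I\<^esub> q) \<mu> = p \<mu> \<oplus>\<^bsub>A\<^esub> q \<mu>"
  by (simp add: mpoly_ring_def)

lemma mpoly_zero: "\<zero>\<^bsub>mpoly_ring A I\<^esub> = (\<lambda>\<mu>. \<zero>\<^bsub>A\<^esub>)"
  by (simp add: mpoly_ring_def)

lemma mpoly_one: "\<one>\<^bsub>mpoly_ring A I\<^esub> = mpoly_monom A 0"
  by (simp add: mpoly_ring_def)

lemma mpoly_mult:
  "(p \<otimes>\<^bsub>mpoly_ring A I\<^esub> q) \<mu> = (\<Oplus>\<^bsub>A\<^esub>x\<in>splits \<mu>. p (fst x) \<otimes>\<^bsub>A\<^esub> q (snd x))"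
  by (simp add: mpoly_ring_def splits_def)

section \<open>Ring axioms for polynomials\<close>

locale mpoly = cring A for A :: "('a, 'k) ring_scheme" (structure) +
  fixes I :: "'i set"
begin

abbreviation P :: "(('i \<Rightarrow>\<^sub>0 nat) \<Rightarrow> 'a) ring"
  where "P \<equiv> mpoly_ring A I"

lemma coeff_closed [simp]: "p \<in> carrier P \<Longrightarrow> p \<mu> \<in> carrier A"
  by (simp add: mpoly_carrier_iff)

lemma mpoly_carrierI:
  assumes "\<And>\<mu>. p \<mu> \<in> carrier A"
    and "finite S"
    and "\<And>\<mu>. \<mu> \<notin> S \<Longrightarrow> p \<mu> = \<zero>"
    and "\<And>\<mu>. \<mu> \<notin> exponents I \<Longrightarrow> p \<mu> = \<zero>"
  shows "p \<in> carrier P"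
proof -
  have "{\<mu>. p \<mu> \<noteq> \<zero>} \<subseteq> S"
    using assms(3) by blast
  then show ?thesis
    using assms(1,2,4) finite_subset by (auto simp: mpoly_carrier_iff)
qed

lemma finite_supp: "p \<in> carrier P \<Longrightarrow> finite {\<mu>. p \<mu> \<noteq> \<zero>}"
  by (simp add: mpoly_carrier_iff)

lemma coeff_outside: "\<lbrakk>p \<in> carrier P; \<mu> \<notin> exponents I\<rbrakk> \<Longrightarrow> p \<mu> = \<zero>"
  by (auto simp: mpoly_carrier_iff)

text \<open>If every summand of the convolution vanished, so would the sum. Closure under products,
  the ideal property of \<open>supp_ideal\<close> and the degrees of products all rest on
  this.\<close>

lemma mpoly_mult_supp:
  assumes "p \<in> carrier P" "q \<in> carrier P" "(p \<otimes>\<^bsub>P\<^esub> q) \<mu> \<noteq> \<zero>"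
  obtains \<alpha> \<beta> where "\<mu> = \<alpha> + \<beta>" "p \<alpha> \<noteq> \<zero>" "q \<beta> \<noteq> \<zero>"
proof -
  have "\<exists>x \<in> splits \<mu>. p (fst x) \<otimes> q (snd x) \<noteq> \<zero>"
    using assms(3) add.finprod_one_eqI[of "splits \<mu>" "\<lambda>x. p (fst x) \<otimes> q (snd x)"]
    unfolding mpoly_mult by blast
  then obtain \<alpha> \<beta> where "\<alpha> + \<beta> = \<mu>" "p \<alpha> \<otimes> q \<beta> \<noteq> \<zero>"
    by auto
  then show thesis
    using that[of \<alpha> \<beta>] assms(1,2) l_null r_null coeff_closed by metis
qed

lemma mpoly_mult_coeff_closed:
  "\<lbrakk>p \<in> carrier P; q \<in> carrier P\<rbrakk> \<Longrightarrow> (p \<otimes>\<^bsub>P\<^esub> q) \<mu> \<in> carrier A"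
  unfolding mpoly_mult by (auto intro!: finsum_closed)

lemma mpoly_mult_closed:
  assumes "p \<in> carrier P" "q \<in> carrier P"
  shows "p \<otimes>\<^bsub>P\<^esub> q \<in> carrier P"
proof (rule mpoly_carrierI)
  let ?S = "(\<lambda>(\<alpha>, \<beta>). \<alpha> + \<beta>) ` ({\<mu>. p \<mu> \<noteq> \<zero>} \<times> {\<mu>. q \<mu> \<noteq> \<zero>})"
  show "finite ?S"
    using assms finite_supp by blast
  show "(p \<otimes>\<^bsub>P\<^esub> q) \<mu> = \<zero>" if "\<mu> \<notin> ?S" for \<mu>
    using that by (rule contrapos_np) (auto elim!: mpoly_mult_supp[OF assms])
  show "(p \<otimes>\<^bsub>P\<^esub> q) \<mu> = \<zero>" if "\<mu> \<notin> exponents I" for \<mu>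
    using that
    by (rule contrapos_np)
      (use assms coeff_outside in \<open>fastforce elim!: mpoly_mult_supp[OF assms] simp: exponents_add_iff\<close>)
qed (use assms mpoly_mult_coeff_closed in auto)

lemma mpoly_mult_comm:
  assumes "p \<in> carrier P" "q \<in> carrier P"
  shows "p \<otimes>\<^bsub>P\<^esub> q = q \<otimes>\<^bsub>P\<^esub> p"
proof
  fix \<mu> :: "'i \<Rightarrow>\<^sub>0 nat"
  have "bij_betw prod.swap (splits \<mu>) (splits \<mu>)"
    by (rule bij_betwI[where g = prod.swap]) (auto simp: add.commute)
  then show "(p \<otimes>\<^bsub>P\<^esub> q) \<mu> = (q \<otimes>\<^bsub>P\<^esub> p) \<mu>"
    unfolding mpoly_mult using assms by (intro finsum_bij) (auto simp: m_comm)
qed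

text \<open>Both sides expand into sums over the ways to write \<open>\<mu>\<close> as a sum of
  three exponents, grouped to the left and to the right.\<close>

lemma mpoly_mult_assoc:
  assumes p: "p \<in> carrier P" and q: "q \<in> carrier P" and r: "r \<in> carrier P"
  shows "(p \<otimes>\<^bsub>P\<^esub> q) \<otimes>\<^bsub>P\<^esub> r = p \<otimes>\<^bsub>P\<^esub> (q \<otimes>\<^bsub>P\<^esub> r)"
proof
  fix \<mu>
  have "((p \<otimes>\<^bsub>P\<^esub> q) \<otimes>\<^bsub>P\<^esub> r) \<mu>
      = (\<Oplus>x\<in>splits \<mu>. \<Oplus>y\<in>splits (fst x). p (fst y) \<otimes> q (snd y) \<otimes> r (snd x))"
    unfolding mpoly_mult using p q r
    by (intro finsum_cong') (auto intro!: finsum_closed finsum_ldistr)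
  also have "\<dots> = (\<Oplus>z\<in>Sigma (splits \<mu>) (\<lambda>x. splits (fst x)).
      p (fst (snd z)) \<otimes> q (snd (snd z)) \<otimes> r (snd (fst z)))"
    using p q r by (intro finsum_Sigma) auto
  also have "\<dots> = (\<Oplus>z\<in>Sigma (splits \<mu>) (\<lambda>x. splits (snd x)).
      p (fst (fst z)) \<otimes> (q (fst (snd z)) \<otimes> r (snd (snd z))))"
  proof (rule finsum_bij)
    \<comment> \<open>In the source \<open>\<alpha> = \<gamma> + \<delta>\<close>, so the underlying
      triple is \<open>\<gamma>\<close>, \<open>\<delta>\<close>, \<open>\<beta>\<close>; in the
      target of the inverse the roles change accordingly.\<close>
    show "bij_betw (\<lambda>((\<alpha>, \<beta>), (\<gamma>, \<delta>)). ((\<gamma>, \<delta> + \<beta>), (\<delta>, \<beta>)))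
      (Sigma (splits \<mu>) (\<lambda>x. splits (fst x))) (Sigma (splits \<mu>) (\<lambda>x. splits (snd x)))"
      by (rule bij_betwI[where g = "\<lambda>((\<alpha>, \<beta>), (\<gamma>, \<delta>)). ((\<alpha> + \<gamma>, \<delta>), (\<alpha>, \<gamma>))"])
        (auto simp: add.assoc)
  qed (use p q r in \<open>auto simp: m_assoc\<close>)
  also have "\<dots> = (\<Oplus>x\<in>splits \<mu>. \<Oplus>y\<in>splits (snd x). p (fst x) \<otimes> (q (fst y) \<otimes> r (snd y)))"
    using p q r by (intro finsum_Sigma[symmetric]) auto
  also have "\<dots> = (p \<otimes>\<^bsub>P\<^esub> (q \<otimes>\<^bsub>P\<^esub> r)) \<mu>"
    unfolding mpoly_mult using p q r
    by (intro finsum_cong') (auto intro!: finsum_closed finsum_rdistr[symmetric])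
  finally show "((p \<otimes>\<^bsub>P\<^esub> q) \<otimes>\<^bsub>P\<^esub> r) \<mu> = (p \<otimes>\<^bsub>P\<^esub> (q \<otimes>\<^bsub>P\<^esub> r)) \<mu>" .
qed

definition mterm :: "'a \<Rightarrow> ('i \<Rightarrow>\<^sub>0 nat) \<Rightarrow> ('i \<Rightarrow>\<^sub>0 nat) \<Rightarrow> 'a"
  where "mterm c \<mu> = (\<lambda>\<nu>. if \<nu> = \<mu> then c else \<zero>)"

lemma mpoly_monom_eq_mterm: "mpoly_monom A \<mu> = mterm \<one> \<mu>"
  by (simp add: mpoly_monom_def mterm_def)

lemma mterm_closed:
  "\<lbrakk>c \<in> carrier A; \<mu> \<in> exponents I\<rbrakk> \<Longrightarrow> mterm c \<mu> \<in> carrier P"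
  by (rule mpoly_carrierI[where S = "{\<mu>}"]) (auto simp: mterm_def)

lemma monom_closed: "\<mu> \<in> exponents I \<Longrightarrow> mpoly_monom A \<mu> \<in> carrier P"
  by (simp add: mpoly_monom_eq_mterm mterm_closed)

text \<open>Addition of exponents is cancellative, so \<open>(\<alpha>, \<beta>)\<close> is the only
  split of \<open>\<alpha> + \<beta>\<close> with first entry \<open>\<alpha>\<close>.\<close>

lemma mterm_mult_coeff:
  assumes "c \<in> carrier A" "p \<in> carrier P"
  shows "(mterm c \<alpha> \<otimes>\<^bsub>P\<^esub> p) (\<alpha> + \<beta>) = c \<otimes> p \<beta>"
  unfolding mpoly_mult using assms
  by (subst finsum_single[where a = "(\<alpha>, \<beta>)"]) (auto simp: mterm_def)

lemma mterm_mult_mterm: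
  assumes "c \<in> carrier A" "d \<in> carrier A" "\<alpha> \<in> exponents I" "\<beta> \<in> exponents I"
  shows "mterm c \<alpha> \<otimes>\<^bsub>P\<^esub> mterm d \<beta> = mterm (c \<otimes> d) (\<alpha> + \<beta>)"
proof
  fix \<mu>
  note cl = mterm_closed[OF assms(1,3)] mterm_closed[OF assms(2,4)]
  show "(mterm c \<alpha> \<otimes>\<^bsub>P\<^esub> mterm d \<beta>) \<mu> = mterm (c \<otimes> d) (\<alpha> + \<beta>) \<mu>"
  proof (cases "\<mu> = \<alpha> + \<beta>")
    case True
    then show ?thesis
      using mterm_mult_coeff[OF assms(1) cl(2), of \<alpha> \<beta>] by (simp add: mterm_def)
  next
    case False
    then have "(mterm c \<alpha> \<otimes>\<^bsub>P\<^esub> mterm d \<beta>) \<mu> = \<zero>"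
      by (rule contrapos_np) (erule mpoly_mult_supp[OF cl], auto simp: mterm_def split: if_splits)
    then show ?thesis using False by (simp add: mterm_def)
  qed
qed

lemma zero_in_exponents [simp]: "0 \<in> exponents I"
  by (simp add: exponents_def)

lemma mpoly_one_mult:
  assumes "p \<in> carrier P"
  shows "\<one>\<^bsub>P\<^esub> \<otimes>\<^bsub>P\<^esub> p = p"
proof
  fix \<mu>
  show "(\<one>\<^bsub>P\<^esub> \<otimes>\<^bsub>P\<^esub> p) \<mu> = p \<mu>"
    using mterm_mult_coeff[of \<one> p 0 \<mu>] assms by (simp add: mpoly_one mpoly_monom_eq_mterm)
qed

lemma mpoly_abelian_group: "abelian_group P"
proof (rule abelian_groupI)
  fix p q assume pq: "p \<in> carrier P" "q \<in> carrier P"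
  show "p \<oplus>\<^bsub>P\<^esub> q \<in> carrier P"
    by (rule mpoly_carrierI[where S = "{\<mu>. p \<mu> \<noteq> \<zero>} \<union> {\<mu>. q \<mu> \<noteq> \<zero>}"])
      (use pq finite_supp in \<open>auto simp: mpoly_add coeff_outside\<close>)
  show "p \<oplus>\<^bsub>P\<^esub> q = q \<oplus>\<^bsub>P\<^esub> p"
    using pq by (simp add: mpoly_add fun_eq_iff a_comm)
next
  show "\<zero>\<^bsub>P\<^esub> \<in> carrier P"
    by (simp add: mpoly_carrier_iff mpoly_zero)
next
  fix p assume p: "p \<in> carrier P"
  have "(\<lambda>\<mu>. \<ominus> p \<mu>) \<in> carrier P"
    by (rule mpoly_carrierI[where S = "{\<mu>. p \<mu> \<noteq> \<zero>}"])
      (use p finite_supp in \<open>auto simp: coeff_outside\<close>)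
  moreover have "(\<lambda>\<mu>. \<ominus> p \<mu>) \<oplus>\<^bsub>P\<^esub> p = \<zero>\<^bsub>P\<^esub>"
    using p by (auto simp: mpoly_add mpoly_zero l_neg)
  ultimately show "\<exists>q \<in> carrier P. q \<oplus>\<^bsub>P\<^esub> p = \<zero>\<^bsub>P\<^esub>" by blast
qed (simp_all add: mpoly_add mpoly_zero fun_eq_iff a_assoc)

lemma mpoly_cring: "cring P"
proof (rule cringI)
  show "comm_monoid P"
  proof (rule comm_monoidI)
    show "\<one>\<^bsub>P\<^esub> \<in> carrier P"
      by (simp add: mpoly_one monom_closed)
  qed (fact mpoly_mult_closed mpoly_mult_assoc mpoly_mult_comm mpoly_one_mult)+
  fix p q r assume pqr: "p \<in> carrier P" "q \<in> carrier P" "r \<in> carrier P"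
  show "(p \<oplus>\<^bsub>P\<^esub> q) \<otimes>\<^bsub>P\<^esub> r = p \<otimes>\<^bsub>P\<^esub> r \<oplus>\<^bsub>P\<^esub> q \<otimes>\<^bsub>P\<^esub> r"
  proof
    fix \<mu>
    have "((p \<oplus>\<^bsub>P\<^esub> q) \<otimes>\<^bsub>P\<^esub> r) \<mu>
        = (\<Oplus>x\<in>splits \<mu>. p (fst x) \<otimes> r (snd x) \<oplus> q (fst x) \<otimes> r (snd x))"
      unfolding mpoly_mult mpoly_add using pqr by (intro finsum_cong') (auto simp: l_distr)
    also have "\<dots> = (p \<otimes>\<^bsub>P\<^esub> r \<oplus>\<^bsub>P\<^esub> q \<otimes>\<^bsub>P\<^esub> r) \<mu>"
      unfolding mpoly_mult mpoly_add using pqr by (intro finsum_addf) auto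
    finally show "((p \<oplus>\<^bsub>P\<^esub> q) \<otimes>\<^bsub>P\<^esub> r) \<mu> = (p \<otimes>\<^bsub>P\<^esub> r \<oplus>\<^bsub>P\<^esub> q \<otimes>\<^bsub>P\<^esub> r) \<mu>" .
  qed
qed (rule mpoly_abelian_group)

sublocale P: cring P
  by (rule mpoly_cring)

end

section \<open>Monomial ideals\<close>

definition exp_le :: "('i \<Rightarrow>\<^sub>0 nat) \<Rightarrow> ('i \<Rightarrow>\<^sub>0 nat) \<Rightarrow> bool"
  where "exp_le \<mu> \<nu> \<longleftrightarrow> (\<forall>i. Poly_Mapping.lookup \<mu> i \<le> Poly_Mapping.lookup \<nu> i)"

lemma exp_le_refl [simp]: "exp_le \<mu> \<mu>"
  by (simp add: exp_le_def)

lemma exp_le_trans: "\<lbrakk>exp_le \<mu> \<nu>; exp_le \<nu> \<rho>\<rbrakk> \<Longrightarrow> exp_le \<mu> \<rho>"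
  unfolding exp_le_def using le_trans by blast

lemma exp_le_antisym: "\<lbrakk>exp_le \<mu> \<nu>; exp_le \<nu> \<mu>\<rbrakk> \<Longrightarrow> \<mu> = \<nu>"
  by (rule poly_mapping_eqI) (simp add: exp_le_def le_antisym)

lemma exp_le_iff_add: "exp_le \<mu> \<nu> \<longleftrightarrow> (\<exists>\<gamma>. \<nu> = \<mu> + \<gamma>)"
proof
  assume "exp_le \<mu> \<nu>"
  then have "\<nu> = \<mu> + (\<nu> - \<mu>)"
    by (intro poly_mapping_eqI) (simp add: exp_le_def lookup_add lookup_minus)
  then show "\<exists>\<gamma>. \<nu> = \<mu> + \<gamma>" ..
qed (auto simp: exp_le_def lookup_add)

lemma finite_exp_le: "finite {\<nu>. exp_le \<nu> \<mu>}"
  unfolding exp_le_def by (rule finite_exponents_le)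

definition min_elems :: "('i \<Rightarrow>\<^sub>0 nat) set \<Rightarrow> ('i \<Rightarrow>\<^sub>0 nat) set"
  where "min_elems U = {\<mu> \<in> U. \<forall>\<nu> \<in> U. exp_le \<nu> \<mu> \<longrightarrow> \<nu> = \<mu>}"

text \<open>Descent on the number of divisors: an exponent that is not minimal has a member of
  \<open>U\<close> strictly below it, with strictly fewer exponents below. The set \<open>U\<close>
  may have infinitely many minimal elements.\<close>

lemma min_elems_below:
  assumes "\<mu> \<in> U"
  shows "\<exists>m \<in> min_elems U. exp_le m \<mu>"
  using assms
proof (induction "card {\<nu>. exp_le \<nu> \<mu>}" arbitrary: \<mu> rule: less_induct)
  case less
  show ?case
  proof (cases "\<mu> \<in> min_elems U")
    case True
    then show ?thesis using exp_le_refl by blast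
  next
    case False
    then obtain \<nu> where \<nu>: "\<nu> \<in> U" "exp_le \<nu> \<mu>" "\<nu> \<noteq> \<mu>"
      using less.prems by (auto simp: min_elems_def)
    have "{\<rho>. exp_le \<rho> \<nu>} \<subset> {\<rho>. exp_le \<rho> \<mu>}"
      using \<nu> exp_le_trans exp_le_antisym by (intro psubsetI) (blast, use exp_le_refl in blast)
    then have "card {\<rho>. exp_le \<rho> \<nu>} < card {\<rho>. exp_le \<rho> \<mu>}"
      using finite_exp_le psubset_card_mono by blast
    from less.hyps[OF this \<nu>(1)] show ?thesis
      using \<nu>(2) exp_le_trans by blast
  qed
qed

definition squarefree_part :: "('i \<Rightarrow>\<^sub>0 nat) \<Rightarrow> ('i \<Rightarrow>\<^sub>0 nat)"
  where "squarefree_part \<mu> = Poly_Mapping.map (\<lambda>_. 1) \<mu>"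

lemma lookup_squarefree_part [simp]:
  "Poly_Mapping.lookup (squarefree_part \<mu>) i = (if Poly_Mapping.lookup \<mu> i = 0 then 0 else 1)"
  by (simp add: squarefree_part_def Poly_Mapping.map.rep_eq when_def)

lemma squarefree_part_exponents: "\<mu> \<in> exponents I \<Longrightarrow> squarefree_part \<mu> \<in> exponents I"
  by (auto simp: exponents_def in_keys_iff split: if_splits)

section \<open>Ideals described by the exponents of their members\<close>

context mpoly
begin

text \<open>A polynomial is the sum of its terms. The induction runs over a finite superset of the
  support, so the removed term may be zero, which accounts for the case
  \<open>p s = \<zero>\<close>.\<close>

lemma mpoly_ideal_decomp:
  assumes "ideal J P"
    and "p \<in> carrier P"
    and "\<And>\<mu>. p \<mu> \<noteq> \<zero> \<Longrightarrow> mterm (p \<mu>) \<mu> \<in> J"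
  shows "p \<in> J"
proof -
  have "p \<in> J" if "finite S" "p \<in> carrier P" "{\<mu>. p \<mu> \<noteq> \<zero>} \<subseteq> S"
    "\<And>\<mu>. p \<mu> \<noteq> \<zero> \<Longrightarrow> mterm (p \<mu>) \<mu> \<in> J" for S p
    using that
  proof (induction S arbitrary: p rule: finite_induct)
    case empty
    then have "p = \<zero>\<^bsub>P\<^esub>"
      by (auto simp: mpoly_zero)
    then show ?case
      using assms(1) additive_subgroup.zero_closed ideal.axioms(1) by blast
  next
    case (insert s S)
    let ?q = "p(s := \<zero>)"
    have q: "?q \<in> carrier P"
      by (rule mpoly_carrierI[where S = S])
        (use insert.prems insert.hyps coeff_outside in auto)
    have "?q \<in> J"
    proof (rule insert.IH[OF q])
      show "{\<mu>. ?q \<mu> \<noteq> \<zero>} \<subseteq> S"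
        using insert.prems(2) by auto
      show "mterm (?q \<mu>) \<mu> \<in> J" if "?q \<mu> \<noteq> \<zero>" for \<mu>
        using insert.prems(3)[of \<mu>] that by (cases "\<mu> = s") simp_all
    qed
    moreover have "p = mterm (p s) s \<oplus>\<^bsub>P\<^esub> ?q"
      using insert.prems(1) by (auto simp: fun_eq_iff mpoly_add mterm_def)
    moreover have "mterm (p s) s \<in> J"
    proof (cases "p s = \<zero>")
      case True
      then have "mterm (p s) s = \<zero>\<^bsub>P\<^esub>"
        by (auto simp: mterm_def mpoly_zero)
      then show ?thesis
        using assms(1) additive_subgroup.zero_closed ideal.axioms(1) by fastforce
    qed (use insert.prems(3) in blast)
    ultimately show ?case
      using assms(1) additive_subgroup.a_closed ideal.axioms(1) by metis
  qed
  then show ?thesis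
    using assms(2,3) finite_supp by blast
qed

text \<open>The exponents of the multiples of the monomials in \<open>S\<close>. Questions on
  monomial ideals become questions on these sets through \<open>genideal_monoms\<close> and
  \<open>supp_ideal_mono_iff\<close>.\<close>

definition upset :: "('i \<Rightarrow>\<^sub>0 nat) set \<Rightarrow> ('i \<Rightarrow>\<^sub>0 nat) set"
  where "upset S = {\<mu> \<in> exponents I. \<exists>s \<in> S. exp_le s \<mu>}"

definition supp_ideal :: "('i \<Rightarrow>\<^sub>0 nat) set \<Rightarrow> (('i \<Rightarrow>\<^sub>0 nat) \<Rightarrow> 'a) set"
  where "supp_ideal U = {p \<in> carrier P. \<forall>\<mu>. p \<mu> \<noteq> \<zero> \<longrightarrow> \<mu> \<in> U}"

lemma upset_subset: "upset S \<subseteq> exponents I"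
  by (auto simp: upset_def)

lemma upset_self: "S \<subseteq> exponents I \<Longrightarrow> S \<subseteq> upset S"
  unfolding upset_def using exp_le_refl by blast

lemma upset_subset_iff: "S \<subseteq> exponents I \<Longrightarrow> upset S \<subseteq> upset T \<longleftrightarrow> S \<subseteq> upset T"
proof
  assume "S \<subseteq> upset T"
  then show "upset S \<subseteq> upset T"
    unfolding upset_def by (auto dest!: subsetD intro: exp_le_trans)
qed (use upset_self in blast)

lemma upset_add: "\<lbrakk>\<mu> \<in> upset S; \<gamma> \<in> exponents I\<rbrakk> \<Longrightarrow> \<mu> + \<gamma> \<in> upset S"
proof -
  assume \<mu>: "\<mu> \<in> upset S" and \<gamma>: "\<gamma> \<in> exponents I"
  have "exp_le \<mu> (\<mu> + \<gamma>)"
    using exp_le_iff_add by blast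
  then show ?thesis
    using \<mu> \<gamma> exponents_add_iff exp_le_trans unfolding upset_def by blast
qed

lemma mpoly_a_inv:
  assumes "p \<in> carrier P"
  shows "(\<ominus>\<^bsub>P\<^esub> p) \<mu> = \<ominus> p \<mu>"
proof -
  have "(\<ominus>\<^bsub>P\<^esub> p) \<mu> \<oplus> p \<mu> = \<zero>"
    using fun_cong[OF P.l_neg[OF assms], of \<mu>] by (simp add: mpoly_add mpoly_zero)
  then show ?thesis
    using minus_equality[of "(\<ominus>\<^bsub>P\<^esub> p) \<mu>" "p \<mu>"] assms P.a_inv_closed by simp
qed

lemma supp_ideal_is_ideal: "ideal (supp_ideal (upset S)) P"
proof (rule idealI)
  let ?J = "supp_ideal (upset S)"
  show "ring P" by (rule P.ring_axioms)
  have zero: "\<zero>\<^bsub>P\<^esub> \<in> ?J"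
    using P.zero_closed by (auto simp: supp_ideal_def mpoly_zero)
  have add: "p \<oplus>\<^bsub>P\<^esub> q \<in> ?J" if "p \<in> ?J" "q \<in> ?J" for p q
  proof -
    have "\<mu> \<in> upset S" if "p \<mu> \<oplus> q \<mu> \<noteq> \<zero>" for \<mu>
      using that \<open>p \<in> ?J\<close> \<open>q \<in> ?J\<close> by (cases "p \<mu> = \<zero>") (auto simp: supp_ideal_def)
    then show ?thesis
      using that P.a_closed by (simp add: supp_ideal_def mpoly_add)
  qed
  have inv: "\<ominus>\<^bsub>P\<^esub> p \<in> ?J" if "p \<in> ?J" for p
    using that mpoly_a_inv[of p] by (auto simp: supp_ideal_def)
  show "subgroup ?J (add_monoid P)"
  proof (rule P.add.subgroupI)
    show "?J \<subseteq> carrier P"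
      by (auto simp: supp_ideal_def)
    show "?J \<noteq> {}"
      using zero by blast
  qed (simp_all add: add inv flip: a_inv_def)
  fix p q assume pq: "p \<in> ?J" "q \<in> carrier P"
  then have p: "p \<in> carrier P" by (simp add: supp_ideal_def)
  have "\<mu> \<in> upset S" if nz: "(p \<otimes>\<^bsub>P\<^esub> q) \<mu> \<noteq> \<zero>" for \<mu>
  proof -
    obtain \<alpha> \<beta> where ab: "\<mu> = \<alpha> + \<beta>" "p \<alpha> \<noteq> \<zero>" "q \<beta> \<noteq> \<zero>"
      by (rule mpoly_mult_supp[OF p pq(2) nz])
    have "\<alpha> \<in> upset S" "\<beta> \<in> exponents I"
      using ab pq coeff_outside[of q \<beta>] by (auto simp: supp_ideal_def)
    then show ?thesis
      using ab(1) upset_add by simp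
  qed
  then have "p \<otimes>\<^bsub>P\<^esub> q \<in> ?J"
    using p pq(2) by (simp add: supp_ideal_def)
  then show "p \<otimes>\<^bsub>P\<^esub> q \<in> ?J" "q \<otimes>\<^bsub>P\<^esub> p \<in> ?J"
    using P.m_comm[OF p pq(2)] by simp_all
qed

lemma monom_in_supp_ideal: "\<mu> \<in> U \<Longrightarrow> U \<subseteq> exponents I \<Longrightarrow> mpoly_monom A \<mu> \<in> supp_ideal U"
  unfolding supp_ideal_def using monom_closed by (auto simp: mpoly_monom_def)

lemma monom_image_closed: "S \<subseteq> exponents I \<Longrightarrow> mpoly_monom A ` S \<subseteq> carrier P"
  using monom_closed by blast

text \<open>A term with exponent \<open>\<mu> = s + \<gamma>\<close> is the generator with exponent
  \<open>s\<close> times a term with exponent \<open>\<gamma>\<close>; a polynomial supported on the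
  upset is a sum of such terms.\<close>

lemma genideal_monoms:
  assumes "S \<subseteq> exponents I"
  shows "Idl\<^bsub>P\<^esub> (mpoly_monom A ` S) = supp_ideal (upset S)"
proof (rule subset_antisym)
  let ?J = "Idl\<^bsub>P\<^esub> (mpoly_monom A ` S)"
  show "?J \<subseteq> supp_ideal (upset S)"
    using upset_self[OF assms] monom_in_supp_ideal upset_subset
    by (intro P.genideal_minimal supp_ideal_is_ideal) blast
  have J: "ideal ?J P"
    using monom_image_closed[OF assms] by (rule P.genideal_ideal)
  show "supp_ideal (upset S) \<subseteq> ?J"
  proof
    fix p assume p: "p \<in> supp_ideal (upset S)"
    then have pc: "p \<in> carrier P" by (simp add: supp_ideal_def)
    show "p \<in> ?J"
    proof (rule mpoly_ideal_decomp[OF J pc])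
      fix \<mu> assume "p \<mu> \<noteq> \<zero>"
      then have "\<mu> \<in> upset S"
        using p by (simp add: supp_ideal_def)
      then obtain s \<gamma> where s: "s \<in> S" "\<mu> = s + \<gamma>" "s \<in> exponents I" "\<gamma> \<in> exponents I"
        by (auto simp: upset_def exp_le_iff_add exponents_add_iff)
      have "mpoly_monom A s \<in> ?J"
        using s(1) P.genideal_self[OF monom_image_closed[OF assms]] by blast
      then have "mpoly_monom A s \<otimes>\<^bsub>P\<^esub> mterm (p \<mu>) \<gamma> \<in> ?J"
        using ideal.I_r_closed[OF J] mterm_closed pc s(4) coeff_closed by blast
      then show "mterm (p \<mu>) \<mu> \<in> ?J"
        using s pc by (simp add: mpoly_monom_eq_mterm mterm_mult_mterm)
    qed
  qed
qed

lemma monom_pow: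
  assumes "\<mu> \<in> exponents I"
  shows "\<exists>\<nu> \<in> exponents I. mpoly_monom A \<mu> [^]\<^bsub>P\<^esub> (n::nat) = mpoly_monom A \<nu> \<and>
    (\<forall>i. Poly_Mapping.lookup \<nu> i = n * Poly_Mapping.lookup \<mu> i)"
proof (induction n)
  case 0
  then show ?case
    by (intro bexI[of _ 0]) (simp_all add: mpoly_one)
next
  case (Suc n)
  then obtain \<nu> where "\<nu> \<in> exponents I" "mpoly_monom A \<mu> [^]\<^bsub>P\<^esub> n = mpoly_monom A \<nu>"
    "\<forall>i. Poly_Mapping.lookup \<nu> i = n * Poly_Mapping.lookup \<mu> i"
    by blast
  then show ?case
    using assms
    by (intro bexI[of _ "\<nu> + \<mu>"])
      (simp_all add: mpoly_monom_eq_mterm mterm_mult_mterm lookup_add exponents_add_iff)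
qed

text \<open>Over the zero ring a monomial is the zero polynomial and lies in every ideal. For
  \<open>\<one> \<noteq> \<zero>\<close> its coefficient at \<open>\<mu>\<close> is visible, and
  ideals determine their exponents.\<close>

lemma monom_in_supp_ideal_iff:
  assumes "\<one> \<noteq> \<zero>"
    and "U \<subseteq> exponents I"
  shows "mpoly_monom A \<mu> \<in> supp_ideal U \<longleftrightarrow> \<mu> \<in> U"
  using assms monom_in_supp_ideal[of \<mu> U] by (auto simp: supp_ideal_def mpoly_monom_def)

lemma supp_ideal_mono_iff:
  assumes "\<one> \<noteq> \<zero>"
  shows "supp_ideal (upset S) \<subseteq> supp_ideal (upset T) \<longleftrightarrow> upset S \<subseteq> upset T"
proof
  assume "supp_ideal (upset S) \<subseteq> supp_ideal (upset T)"
  then show "upset S \<subseteq> upset T"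
    using monom_in_supp_ideal_iff[OF assms upset_subset] by blast
qed (auto simp: supp_ideal_def)

lemma supp_ideal_eq_iff:
  assumes "\<one> \<noteq> \<zero>"
  shows "supp_ideal (upset S) = supp_ideal (upset T) \<longleftrightarrow> upset S = upset T"
  using supp_ideal_mono_iff[OF assms] by (metis subset_antisym order_refl)

lemma min_elems_upset_subset: "min_elems (upset S) \<subseteq> exponents I"
  by (auto simp: min_elems_def upset_def)

lemma upset_min_elems: "upset (min_elems (upset S)) = upset S"
proof
  show "upset (min_elems (upset S)) \<subseteq> upset S"
    using min_elems_upset_subset by (subst upset_subset_iff) (auto simp: min_elems_def)
  show "upset S \<subseteq> upset (min_elems (upset S))"
    using min_elems_below[of _ "upset S"] by (auto simp: upset_def)
qed

text \<open>Below a minimal \<open>m\<close> lies some element of \<open>E\<close>, and minimality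
  makes it equal to \<open>m\<close>. This yields both the uniqueness of minimal generators and
  their finiteness.\<close>

lemma min_elems_upset_least:
  assumes "E \<subseteq> exponents I"
    and "upset E = upset S"
  shows "min_elems (upset S) \<subseteq> E"
proof
  fix m assume m: "m \<in> min_elems (upset S)"
  then obtain e where "e \<in> E" "exp_le e m"
    using assms(2) by (auto simp: min_elems_def upset_def)
  moreover have "e \<in> upset S"
    using upset_self[OF assms(1)] \<open>e \<in> E\<close> assms(2) by blast
  ultimately show "m \<in> E"
    using m by (auto simp: min_elems_def)
qed

text \<open>This evaluates the \<open>THE\<close> in \<open>min_exponents\<close> over a nonzero
  ring. Every generating set of exponents contains the minimal ones, and these already generate, so
  a minimal generating set has no others.\<close>

lemma min_monomial_generators_iff:
  assumes "\<one> \<noteq> \<zero>"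
  shows "min_monomial_generators A I (supp_ideal (upset S)) E \<longleftrightarrow> E = min_elems (upset S)"
proof
  let ?M = "min_elems (upset S)"
  assume E: "min_monomial_generators A I (supp_ideal (upset S)) E"
  then have Esub: "E \<subseteq> exponents I" and "Idl\<^bsub>P\<^esub> (mpoly_monom A ` E) = supp_ideal (upset S)"
    and minimal: "\<And>T. T \<subset> mpoly_monom A ` E \<Longrightarrow> Idl\<^bsub>P\<^esub> T \<noteq> supp_ideal (upset S)"
    unfolding min_monomial_generators_def by simp_all
  then have "upset E = upset S"
    using genideal_monoms[OF Esub] supp_ideal_eq_iff[OF assms] by simp
  then have "?M \<subseteq> E"
    by (rule min_elems_upset_least[OF Esub])
  moreover have "\<not> ?M \<subset> E"
  proof
    assume "?M \<subset> E"
    \<comment> \<open>Minimality is stated for sets of monomials, so strict inclusion has to be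
      carried over from exponents; this uses \<open>\<one> \<noteq> \<zero>\<close>.\<close>
    moreover have "inj_on (mpoly_monom A) E"
    proof (rule inj_onI)
      fix \<mu> \<nu> assume "mpoly_monom A \<mu> = mpoly_monom A \<nu>"
      from fun_cong[OF this, of \<mu>] show "\<mu> = \<nu>"
        using assms by (simp add: mpoly_monom_def split: if_splits)
    qed
    ultimately have "mpoly_monom A ` ?M \<subset> mpoly_monom A ` E"
      by (intro image_strict_mono)
    moreover have "Idl\<^bsub>P\<^esub> (mpoly_monom A ` ?M) = supp_ideal (upset S)"
      using genideal_monoms[OF min_elems_upset_subset] upset_min_elems by simp
    ultimately show False
      using minimal by blast
  qed
  ultimately show "E = ?M"
    by blast
next
  let ?M = "min_elems (upset S)"
  assume E: "E = ?M"
  have "Idl\<^bsub>P\<^esub> T \<noteq> supp_ideal (upset S)" if T: "T \<subset> mpoly_monom A ` ?M" for T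
  proof
    assume eq: "Idl\<^bsub>P\<^esub> T = supp_ideal (upset S)"
    obtain E' where E': "E' \<subseteq> ?M" "T = mpoly_monom A ` E'"
      using T by (meson psubset_imp_subset subset_imageE)
    then have E'sub: "E' \<subseteq> exponents I"
      using min_elems_upset_subset by blast
    then have "upset E' = upset S"
      using eq E'(2) genideal_monoms[OF E'sub] supp_ideal_eq_iff[OF assms] by simp
    then have "?M \<subseteq> E'"
      by (rule min_elems_upset_least[OF E'sub])
    then show False
      using T E' by blast
  qed
  then show "min_monomial_generators A I (supp_ideal (upset S)) E"
    using E genideal_monoms[OF min_elems_upset_subset, of S] upset_min_elems[of S]
      min_elems_upset_subset[of S]
    by (simp add: min_monomial_generators_def)
qed

section \<open>The floor ideal and its radical\<close>

lemma floor_supp_ideal: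
  assumes "\<one> \<noteq> \<zero>"
  shows "floor_ideal A I (supp_ideal (upset S))
    = supp_ideal (upset (squarefree_part ` min_elems (upset S)))"
proof -
  have "min_exponents A I (supp_ideal (upset S)) = min_elems (upset S)"
    unfolding min_exponents_def by (rule the_equality) (simp_all add: min_monomial_generators_iff[OF assms])
  moreover have "squarefree_part ` min_elems (upset S) \<subseteq> exponents I"
    using squarefree_part_exponents min_elems_upset_subset by blast
  ultimately show ?thesis
    using genideal_monoms unfolding floor_ideal_def squarefree_part_def[symmetric] by (metis image_image)
qed

text \<open>The given finite generating set consists of polynomials, not of monomials. The exponents
  occurring in it form a finite set with the same upset, and such a set contains every minimal
  element.\<close>

lemma finite_min_elems:
  assumes "finite_type_ideal P (supp_ideal (upset S))"
    and "S \<subseteq> exponents I"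
    and "\<one> \<noteq> \<zero>"
  shows "finite (min_elems (upset S))"
proof -
  obtain F where F: "finite F" "F \<subseteq> carrier P" "supp_ideal (upset S) = Idl\<^bsub>P\<^esub> F"
    using assms(1) by (auto simp: finite_type_ideal_def)
  let ?Q = "\<Union>f\<in>F. {\<mu>. f \<mu> \<noteq> \<zero>}"
  have "finite ?Q"
    using F(1,2) finite_supp by blast
  have "F \<subseteq> supp_ideal (upset S)"
    using P.genideal_self[OF F(2)] F(3) by simp
  then have Q: "?Q \<subseteq> upset S"
    by (auto simp: supp_ideal_def)
  then have Qe: "?Q \<subseteq> exponents I"
    using upset_subset by blast
  have "F \<subseteq> supp_ideal (upset ?Q)"
    using F(2) upset_self[OF Qe] by (auto simp: supp_ideal_def)
  then have "supp_ideal (upset S) \<subseteq> supp_ideal (upset ?Q)"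
    unfolding F(3) by (intro P.genideal_minimal supp_ideal_is_ideal)
  then have "upset S \<subseteq> upset ?Q"
    using supp_ideal_mono_iff[OF assms(3)] by simp
  moreover have "upset ?Q \<subseteq> upset S"
    using upset_subset_iff[OF Qe] Q by simp
  ultimately have "min_elems (upset S) \<subseteq> ?Q"
    by (intro min_elems_upset_least Qe) simp
  then show ?thesis
    using \<open>finite ?Q\<close> finite_subset by blast
qed

lemma floor_finite_type:
  assumes "finite_type_ideal P (supp_ideal (upset S))"
    and "S \<subseteq> exponents I"
    and "\<one> \<noteq> \<zero>"
  shows "finite_type_ideal P (floor_ideal A I (supp_ideal (upset S)))"
proof -
  have "squarefree_part ` min_elems (upset S) \<subseteq> exponents I"
    using squarefree_part_exponents min_elems_upset_subset by blast
  then show ?thesis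
    unfolding finite_type_ideal_def floor_supp_ideal[OF assms(3)]
    using finite_min_elems[OF assms] monom_image_closed genideal_monoms
    by (intro exI[of _ "mpoly_monom A ` squarefree_part ` min_elems (upset S)"]) auto
qed

lemma subset_floor:
  assumes "\<one> \<noteq> \<zero>"
  shows "supp_ideal (upset S) \<subseteq> floor_ideal A I (supp_ideal (upset S))"
proof -
  have "exp_le (squarefree_part \<mu>) \<mu>" for \<mu> :: "'i \<Rightarrow>\<^sub>0 nat"
    by (auto simp: exp_le_def)
  then have "\<exists>m \<in> min_elems (upset S). exp_le (squarefree_part m) \<mu>" if "\<mu> \<in> upset S" for \<mu>
    using min_elems_below[OF that] exp_le_trans by blast
  then have "upset S \<subseteq> upset (squarefree_part ` min_elems (upset S))"
    by (auto simp: upset_def[of "squarefree_part ` _"] dest: subsetD[OF upset_subset])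
  then show ?thesis
    by (simp add: floor_supp_ideal assms supp_ideal_mono_iff)
qed

lemma supp_ideal_closed: "supp_ideal U \<subseteq> carrier P"
  by (auto simp: supp_ideal_def)

lemma squarefree_part_in_radical:
  assumes "\<mu> \<in> upset S"
  shows "mpoly_monom A (squarefree_part \<mu>) \<in> radical P (supp_ideal (upset S))"
proof -
  have \<mu>: "\<mu> \<in> exponents I" using assms upset_subset by blast
  then have s: "squarefree_part \<mu> \<in> exponents I" by (rule squarefree_part_exponents)
  \<comment> \<open>The total degree of \<open>\<mu>\<close> bounds each of its entries, so the
    power \<open>n\<close> of the squarefree monomial is divisible by the monomial of
    \<open>\<mu>\<close>; for \<open>\<mu> = 0\<close> it is zero.\<close>
  define n where "n = (\<Sum>i\<in>Poly_Mapping.keys \<mu>. Poly_Mapping.lookup \<mu> i)"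
  obtain \<nu> where \<nu>: "\<nu> \<in> exponents I" "mpoly_monom A (squarefree_part \<mu>) [^]\<^bsub>P\<^esub> n = mpoly_monom A \<nu>"
    "\<forall>i. Poly_Mapping.lookup \<nu> i = n * Poly_Mapping.lookup (squarefree_part \<mu>) i"
    using monom_pow[OF s, of n] by blast
  have "Poly_Mapping.lookup \<mu> i \<le> n" if "i \<in> Poly_Mapping.keys \<mu>" for i
    unfolding n_def using that by (intro member_le_sum) auto
  then have "exp_le \<mu> \<nu>"
    using \<nu>(3) by (auto simp: exp_le_def in_keys_iff)
  then have "\<nu> \<in> upset S"
    using assms \<nu>(1) exp_le_trans by (auto simp: upset_def)
  then have "mpoly_monom A \<nu> \<in> supp_ideal (upset S)"
    using monom_in_supp_ideal upset_subset by blast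
  then show ?thesis
    using \<nu>(2) monom_closed[OF s] unfolding radical_def by (intro CollectI conjI exI[of _ n]) simp_all
qed

lemma floor_subset_radical:
  assumes "finite_type_ideal P (supp_ideal (upset S))"
    and "S \<subseteq> exponents I"
    and "\<one> \<noteq> \<zero>"
  shows "floor_ideal A I (supp_ideal (upset S)) \<subseteq> radical P (supp_ideal (upset S))"
proof -
  let ?E = "squarefree_part ` min_elems (upset S)"
  have E: "?E \<subseteq> exponents I"
    using squarefree_part_exponents min_elems_upset_subset by blast
  have "mpoly_monom A ` ?E \<subseteq> radical P (supp_ideal (upset S))"
    using squarefree_part_in_radical by (auto simp: min_elems_def)
  moreover have "finite ?E"
    using finite_min_elems[OF assms] by simp
  ultimately have "Idl\<^bsub>P\<^esub> (mpoly_monom A ` ?E) \<subseteq> radical P (supp_ideal (upset S))"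
    using monom_image_closed[OF E] by (intro P.genideal_subset_radical supp_ideal_is_ideal) auto
  then show ?thesis
    by (simp add: floor_supp_ideal[OF assms(3)] genideal_monoms[OF E])
qed

text \<open>The floor is squeezed between the ideal and the radical of the ideal.\<close>

lemma radical_floor:
  assumes "finite_type_ideal P (supp_ideal (upset S))"
    and "S \<subseteq> exponents I"
    and "\<one> \<noteq> \<zero>"
  shows "radical P (floor_ideal A I (supp_ideal (upset S))) = radical P (supp_ideal (upset S))"
proof
  show "radical P (floor_ideal A I (supp_ideal (upset S))) \<subseteq> radical P (supp_ideal (upset S))"
    by (rule P.radical_mono_radical[OF floor_finite_type[OF assms] supp_ideal_is_ideal
          floor_subset_radical[OF assms]])
  show "radical P (supp_ideal (upset S)) \<subseteq> radical P (floor_ideal A I (supp_ideal (upset S)))"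
    using subset_floor[OF assms(3)] by (auto simp: radical_def)
qed

text \<open>Multiplying an exponent by \<open>n\<close> does not enlarge its support. A minimal
  \<open>m\<close> of \<open>upset T\<close> below \<open>n\<close> times \<open>\<mu>\<close>
  therefore has its support inside that of \<open>\<mu>\<close>, and for squarefree monomials
  inclusion of supports is divisibility.\<close>

lemma floor_mono_radical:
  assumes "\<one> \<noteq> \<zero>"
    and "supp_ideal (upset S) \<subseteq> radical P (supp_ideal (upset T))"
  shows "floor_ideal A I (supp_ideal (upset S)) \<subseteq> floor_ideal A I (supp_ideal (upset T))"
proof -
  let ?sq = "\<lambda>S. squarefree_part ` min_elems (upset S)"
  have "squarefree_part \<mu> \<in> upset (?sq T)" if "\<mu> \<in> upset S" for \<mu>
  proof -
    have \<mu>: "\<mu> \<in> exponents I" using that upset_subset by blast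
    have "mpoly_monom A \<mu> \<in> radical P (supp_ideal (upset T))"
      using that assms(2) monom_in_supp_ideal[OF _ upset_subset] by blast
    then obtain n :: nat where "mpoly_monom A \<mu> [^]\<^bsub>P\<^esub> n \<in> supp_ideal (upset T)"
      by (auto simp: radical_def)
    then obtain \<nu> where \<nu>: "mpoly_monom A \<nu> \<in> supp_ideal (upset T)"
      "\<forall>i. Poly_Mapping.lookup \<nu> i = n * Poly_Mapping.lookup \<mu> i"
      using monom_pow[OF \<mu>, of n] by auto
    then have "\<nu> \<in> upset T"
      using monom_in_supp_ideal_iff[OF assms(1) upset_subset] by simp
    then obtain m where m: "m \<in> min_elems (upset T)" "exp_le m \<nu>"
      using min_elems_below by blast
    then have "Poly_Mapping.lookup m i \<le> n * Poly_Mapping.lookup \<mu> i" for i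
      using \<nu>(2) by (metis exp_le_def)
    then have "Poly_Mapping.lookup m i = 0" if "Poly_Mapping.lookup \<mu> i = 0" for i
      using that by (metis le_zero_eq mult_0_right)
    then have "exp_le (squarefree_part m) (squarefree_part \<mu>)"
      by (simp add: exp_le_def)
    then show ?thesis
      using m(1) squarefree_part_exponents[OF \<mu>] by (auto simp: upset_def)
  qed
  then have "?sq S \<subseteq> upset (?sq T)"
    by (auto simp: min_elems_def)
  moreover have "?sq S \<subseteq> exponents I"
    using squarefree_part_exponents min_elems_upset_subset by blast
  ultimately show ?thesis
    by (simp add: floor_supp_ideal assms(1) supp_ideal_mono_iff upset_subset_iff)
qed

end

section \<open>Torsion of the quotient by a monomial ideal\<close>

context mpoly
begin

text \<open>The normal form modulo \<open>supp_ideal U\<close>; the set \<open>residues U\<close>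
  collects the normal forms.\<close>

definition trunc :: "('i \<Rightarrow>\<^sub>0 nat) set \<Rightarrow> (('i \<Rightarrow>\<^sub>0 nat) \<Rightarrow> 'a) \<Rightarrow> ('i \<Rightarrow>\<^sub>0 nat) \<Rightarrow> 'a"
  where "trunc U p = (\<lambda>\<mu>. if \<mu> \<in> U then \<zero> else p \<mu>)"

definition residues :: "('i \<Rightarrow>\<^sub>0 nat) set \<Rightarrow> (('i \<Rightarrow>\<^sub>0 nat) \<Rightarrow> 'a) set"
  where "residues U = {p \<in> carrier P. \<forall>\<mu> \<in> U. p \<mu> = \<zero>}"

lemma residues_closed: "p \<in> residues U \<Longrightarrow> p \<in> carrier P"
  by (simp add: residues_def)

lemma mpoly_restrict_closed:
  assumes "p \<in> carrier P"
  shows "(\<lambda>\<mu>. if Q \<mu> then p \<mu> else \<zero>) \<in> carrier P"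
  by (rule mpoly_carrierI[where S = "{\<mu>. p \<mu> \<noteq> \<zero>}"])
    (use assms finite_supp coeff_outside in auto)

lemma trunc_residues:
  assumes "p \<in> carrier P"
  shows "trunc U p \<in> residues U"
proof -
  have "trunc U p = (\<lambda>\<mu>. if \<mu> \<notin> U then p \<mu> else \<zero>)"
    by (auto simp: trunc_def)
  then have "trunc U p \<in> carrier P"
    using mpoly_restrict_closed[OF assms] by simp
  then show ?thesis
    by (simp add: residues_def trunc_def)
qed

lemma trunc_id: "p \<in> residues U \<Longrightarrow> trunc U p = p"
  by (auto simp: trunc_def residues_def)

lemma trunc_add: "trunc U (p \<oplus>\<^bsub>P\<^esub> q) = trunc U p \<oplus>\<^bsub>P\<^esub> trunc U q"
  by (rule ext) (simp add: trunc_def mpoly_add)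

lemma residues_add: "\<lbrakk>p \<in> residues U; q \<in> residues U\<rbrakk> \<Longrightarrow> p \<oplus>\<^bsub>P\<^esub> q \<in> residues U"
  using P.a_closed by (simp add: residues_def mpoly_add)

lemma residues_zero: "\<zero>\<^bsub>P\<^esub> \<in> residues U"
  using P.zero_closed by (simp add: residues_def) (simp add: mpoly_zero)

lemma residues_minus: "p \<in> residues U \<Longrightarrow> \<ominus>\<^bsub>P\<^esub> p \<in> residues U"
  using P.a_inv_closed[of p] by (simp add: residues_def mpoly_a_inv)

lemma trunc_eq_zero_iff:
  assumes "p \<in> carrier P"
  shows "trunc U p = \<zero>\<^bsub>P\<^esub> \<longleftrightarrow> p \<in> supp_ideal U"
  using assms by (auto simp: trunc_def supp_ideal_def mpoly_zero fun_eq_iff)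

text \<open>The discarded part of \<open>p\<close> lies in the ideal, hence so does its product with
  \<open>r\<close>, and truncation kills that. It is the reason why scalar multiplication on normal
  forms is associative.\<close>

lemma trunc_mult_trunc:
  assumes "r \<in> carrier P" "p \<in> carrier P"
  shows "trunc (upset S) (r \<otimes>\<^bsub>P\<^esub> trunc (upset S) p) = trunc (upset S) (r \<otimes>\<^bsub>P\<^esub> p)"
proof -
  let ?U = "upset S" and ?d = "\<lambda>\<mu>. if \<mu> \<in> upset S then p \<mu> else \<zero>"
  have t: "trunc ?U p \<in> carrier P"
    using trunc_residues[OF assms(2)] by (rule residues_closed)
  have d: "?d \<in> carrier P"
    using assms(2) by (rule mpoly_restrict_closed)
  then have "?d \<in> supp_ideal ?U"
    by (simp add: supp_ideal_def)
  then have "r \<otimes>\<^bsub>P\<^esub> ?d \<in> supp_ideal ?U"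
    using ideal.I_l_closed[OF supp_ideal_is_ideal] assms(1) by blast
  then have rd: "trunc ?U (r \<otimes>\<^bsub>P\<^esub> ?d) = \<zero>\<^bsub>P\<^esub>"
    using trunc_eq_zero_iff[of "r \<otimes>\<^bsub>P\<^esub> ?d"] assms(1) d by simp
  have "p = trunc ?U p \<oplus>\<^bsub>P\<^esub> ?d"
    using assms(2) by (intro ext) (simp add: trunc_def mpoly_add)
  then have "trunc ?U (r \<otimes>\<^bsub>P\<^esub> p) = trunc ?U (r \<otimes>\<^bsub>P\<^esub> trunc ?U p \<oplus>\<^bsub>P\<^esub> r \<otimes>\<^bsub>P\<^esub> ?d)"
    using P.r_distr[OF t d assms(1)] by simp
  also have "\<dots> = trunc ?U (r \<otimes>\<^bsub>P\<^esub> trunc ?U p)"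
    using rd P.r_zero[OF residues_closed[OF trunc_residues[OF P.m_closed[OF assms(1) t]]]]
    by (simp add: trunc_add)
  finally show ?thesis by simp
qed

text \<open>
  The quotient of the polynomial ring by a monomial ideal has the monomials outside the ideal as a
  basis, so it is realised on the polynomials supported there; the injection \<open>h\<close> moves it to the
  type over which \<open>torsion_functors_eq\<close> quantifies.
\<close>

definition quot_module ::
    "((('i \<Rightarrow>\<^sub>0 nat) \<Rightarrow> 'a) \<Rightarrow> 'm) \<Rightarrow> ('i \<Rightarrow>\<^sub>0 nat) set \<Rightarrow> (('i \<Rightarrow>\<^sub>0 nat) \<Rightarrow> 'a, 'm) module"
  where "quot_module h U =
    \<lparr> carrier = h ` residues U, monoid.mult = undefined, monoid.one = undefined, ring.zero = h \<zero>\<^bsub>P\<^esub>,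
      ring.add = (\<lambda>x y. h (inv_into (carrier P) h x \<oplus>\<^bsub>P\<^esub> inv_into (carrier P) h y)),
      smult = (\<lambda>r x. h (trunc U (r \<otimes>\<^bsub>P\<^esub> inv_into (carrier P) h x))) \<rparr>"

end

section \<open>The quotient as a graded module\<close>

locale mpoly_quotient = mpoly A I + G: comm_group G
  for A :: "('a, 'k) ring_scheme" (structure) and I :: "'i set" and G :: "('g, 'h) monoid_scheme" +
  fixes \<psi> :: "('i \<Rightarrow>\<^sub>0 int) \<Rightarrow> 'g"
    and h :: "(('i \<Rightarrow>\<^sub>0 nat) \<Rightarrow> 'a) \<Rightarrow> 'm"
    and S :: "('i \<Rightarrow>\<^sub>0 nat) set"
  assumes \<psi>_hom: "\<psi> \<in> hom (free_Abelian_group I) G"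
    and h_inj: "inj_on h (carrier P)"
begin

abbreviation "U \<equiv> upset S"
abbreviation "M \<equiv> quot_module h U"
abbreviation "k \<equiv> inv_into (carrier P) h"
abbreviation "mdeg \<mu> \<equiv> \<psi> (Poly_Mapping.map int \<mu>)"
abbreviation "Mgr g \<equiv> h ` (residues U \<inter> mpoly_grading A I \<psi> g)"

lemma k_h [simp]: "p \<in> carrier P \<Longrightarrow> k (h p) = p"
  using h_inj by (rule inv_into_f_f)

lemma carrier_M: "carrier M = h ` residues U"
  by (simp add: quot_module_def)

lemma zero_M: "\<zero>\<^bsub>M\<^esub> = h \<zero>\<^bsub>P\<^esub>"
  by (simp add: quot_module_def)

lemma add_M: "\<lbrakk>p \<in> residues U; q \<in> residues U\<rbrakk> \<Longrightarrow> h p \<oplus>\<^bsub>M\<^esub> h q = h (p \<oplus>\<^bsub>P\<^esub> q)"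
  using residues_closed by (simp add: quot_module_def)

lemma smult_M: "p \<in> residues U \<Longrightarrow> r \<odot>\<^bsub>M\<^esub> h p = h (trunc U (r \<otimes>\<^bsub>P\<^esub> p))"
  using residues_closed by (simp add: quot_module_def)

lemma M_abelian_group: "abelian_group M"
proof (rule abelian_groupI)
  fix x assume "x \<in> carrier M"
  then obtain p where p: "p \<in> residues U" "x = h p"
    by (auto simp: carrier_M)
  then have "h (\<ominus>\<^bsub>P\<^esub> p) \<oplus>\<^bsub>M\<^esub> x = \<zero>\<^bsub>M\<^esub>"
    using add_M[OF residues_minus[OF p(1)] p(1)] P.l_neg[OF residues_closed[OF p(1)]]
    by (simp add: zero_M)
  then show "\<exists>y \<in> carrier M. y \<oplus>\<^bsub>M\<^esub> x = \<zero>\<^bsub>M\<^esub>"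
    using residues_minus[OF p(1)] by (auto simp: carrier_M)
  show "\<zero>\<^bsub>M\<^esub> \<oplus>\<^bsub>M\<^esub> x = x"
    using p P.l_zero[OF residues_closed[OF p(1)]] add_M[OF residues_zero p(1)] by (simp add: zero_M)
  fix y assume "y \<in> carrier M"
  then obtain q where q: "q \<in> residues U" "y = h q"
    by (auto simp: carrier_M)
  show "x \<oplus>\<^bsub>M\<^esub> y \<in> carrier M"
    using p q residues_add by (simp add: add_M carrier_M)
  show "x \<oplus>\<^bsub>M\<^esub> y = y \<oplus>\<^bsub>M\<^esub> x"
    using p q P.a_comm[OF residues_closed[OF p(1)] residues_closed[OF q(1)]] by (simp add: add_M)
  fix z assume "z \<in> carrier M"
  then obtain r where r: "r \<in> residues U" "z = h r"
    by (auto simp: carrier_M)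
  show "(x \<oplus>\<^bsub>M\<^esub> y) \<oplus>\<^bsub>M\<^esub> z = x \<oplus>\<^bsub>M\<^esub> (y \<oplus>\<^bsub>M\<^esub> z)"
    using p q r P.a_assoc[OF residues_closed[OF p(1)] residues_closed[OF q(1)] residues_closed[OF r(1)]]
    by (simp add: add_M residues_add)
next
  show "\<zero>\<^bsub>M\<^esub> \<in> carrier M"
    using residues_zero by (simp add: zero_M carrier_M)
qed

lemma M_module: "module P M"
proof (rule moduleI[OF P.is_cring M_abelian_group])
  fix a x assume a: "a \<in> carrier P" and "x \<in> carrier M"
  then obtain p where p: "p \<in> residues U" "x = h p"
    by (auto simp: carrier_M)
  have pc: "p \<in> carrier P" using p(1) by (rule residues_closed)
  have tr: "trunc U (c \<otimes>\<^bsub>P\<^esub> q) \<in> residues U" if "c \<in> carrier P" "q \<in> residues U" for c q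
    using trunc_residues[OF P.m_closed] that residues_closed by blast
  show "a \<odot>\<^bsub>M\<^esub> x \<in> carrier M"
    using p tr[OF a p(1)] by (simp add: smult_M carrier_M)
  {
    fix y assume "y \<in> carrier M"
    then obtain q where q: "q \<in> residues U" "y = h q"
      by (auto simp: carrier_M)
    show "a \<odot>\<^bsub>M\<^esub> (x \<oplus>\<^bsub>M\<^esub> y) = a \<odot>\<^bsub>M\<^esub> x \<oplus>\<^bsub>M\<^esub> a \<odot>\<^bsub>M\<^esub> y"
      using P.r_distr[OF pc residues_closed[OF q(1)] a] p q a tr
      by (simp add: add_M smult_M residues_add trunc_add)
  }
  fix b assume b: "b \<in> carrier P"
  show "(a \<oplus>\<^bsub>P\<^esub> b) \<odot>\<^bsub>M\<^esub> x = a \<odot>\<^bsub>M\<^esub> x \<oplus>\<^bsub>M\<^esub> b \<odot>\<^bsub>M\<^esub> x"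
    using P.l_distr[OF a b pc] p a b tr by (simp add: add_M smult_M trunc_add)
  show "(a \<otimes>\<^bsub>P\<^esub> b) \<odot>\<^bsub>M\<^esub> x = a \<odot>\<^bsub>M\<^esub> (b \<odot>\<^bsub>M\<^esub> x)"
    using trunc_mult_trunc[OF a P.m_closed[OF b pc]] P.m_assoc[OF a b pc] p tr[OF b p(1)]
    by (simp add: smult_M)
next
  fix x assume "x \<in> carrier M"
  then obtain p where p: "p \<in> residues U" "x = h p"
    by (auto simp: carrier_M)
  then show "\<one>\<^bsub>P\<^esub> \<odot>\<^bsub>M\<^esub> x = x"
    using residues_closed[OF p(1)] by (simp add: smult_M trunc_id)
qed

sublocale M: module P M
  by (rule M_module)

lemma k_closed: "x \<in> carrier M \<Longrightarrow> k x \<in> residues U"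
  using residues_closed by (auto simp: carrier_M)

lemma h_k: "x \<in> carrier M \<Longrightarrow> h (k x) = x"
  using residues_closed by (auto simp: carrier_M)

lemma k_zero: "k \<zero>\<^bsub>M\<^esub> = \<zero>\<^bsub>P\<^esub>"
  using P.zero_closed by (simp add: zero_M)

lemma k_add:
  assumes "x \<in> carrier M" "y \<in> carrier M"
  shows "k (x \<oplus>\<^bsub>M\<^esub> y) = k x \<oplus>\<^bsub>P\<^esub> k y"
proof -
  have "x \<oplus>\<^bsub>M\<^esub> y = h (k x \<oplus>\<^bsub>P\<^esub> k y)"
    using add_M[OF k_closed[OF assms(1)] k_closed[OF assms(2)]] assms by (simp add: h_k)
  then show ?thesis
    using k_h residues_closed residues_add k_closed assms by metis
qed

lemma k_coeff_closed: "x \<in> carrier M \<Longrightarrow> k x \<mu> \<in> carrier A"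
  using k_closed residues_closed coeff_closed by blast

text \<open>Reading off one coefficient is additive, so sums in \<open>M\<close> can be compared
  coefficientwise in \<open>A\<close>.\<close>

lemma k_finsum_coeff:
  assumes "finite B"
    and "\<And>b. b \<in> B \<Longrightarrow> f b \<in> carrier M"
  shows "k (\<Oplus>\<^bsub>M\<^esub>b\<in>B. f b) \<mu> = (\<Oplus>b\<in>B. k (f b) \<mu>)"
  using assms
proof (induction B rule: finite_induct)
  case empty
  then show ?case
    by (simp add: k_zero) (simp add: mpoly_zero)
next
  case (insert b B)
  then have f: "f \<in> B \<rightarrow> carrier M" "f b \<in> carrier M"
    by auto
  have "k (\<Oplus>\<^bsub>M\<^esub>b\<in>insert b B. f b) = k (f b) \<oplus>\<^bsub>P\<^esub> k (\<Oplus>\<^bsub>M\<^esub>b\<in>B. f b)"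
    using insert.hyps f k_add[OF f(2) M.finsum_closed[OF f(1)]] by simp
  moreover have "(\<Oplus>c\<in>insert b B. k (f c) \<mu>) = k (f b) \<mu> \<oplus> (\<Oplus>c\<in>B. k (f c) \<mu>)"
    using insert.hyps f k_coeff_closed by (intro finsum_insert) auto
  moreover have "k (\<Oplus>\<^bsub>M\<^esub>b\<in>B. f b) \<mu> = (\<Oplus>b\<in>B. k (f b) \<mu>)"
    using f(1) by (intro insert.IH) blast
  ultimately show ?case
    by (simp add: mpoly_add)
qed

lemma Mgr_carrier: "x \<in> Mgr g \<Longrightarrow> x \<in> carrier M"
  by (auto simp: carrier_M)

lemma Mgr_iff:
  "x \<in> Mgr g \<longleftrightarrow> x \<in> carrier M \<and> (\<forall>\<mu>. k x \<mu> \<noteq> \<zero> \<longrightarrow> mdeg \<mu> = g)"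
proof
  assume "x \<in> Mgr g"
  then show "x \<in> carrier M \<and> (\<forall>\<mu>. k x \<mu> \<noteq> \<zero> \<longrightarrow> mdeg \<mu> = g)"
    using residues_closed by (auto simp: carrier_M mpoly_grading_def)
next
  assume x: "x \<in> carrier M \<and> (\<forall>\<mu>. k x \<mu> \<noteq> \<zero> \<longrightarrow> mdeg \<mu> = g)"
  then have "k x \<in> residues U \<inter> mpoly_grading A I \<psi> g"
    using k_closed residues_closed by (auto simp: mpoly_grading_def)
  moreover have "x = h (k x)"
    using x h_k by simp
  ultimately show "x \<in> Mgr g"
    using image_eqI[of x h "k x"] by blast
qed

lemma Mgr_subgroup: "additive_subgroup (Mgr g) M"
proof -
  have add: "x \<oplus>\<^bsub>M\<^esub> y \<in> Mgr g" if x: "x \<in> Mgr g" and y: "y \<in> Mgr g" for x y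
  proof -
    have "mdeg \<mu> = g" if "(k x \<oplus>\<^bsub>P\<^esub> k y) \<mu> \<noteq> \<zero>" for \<mu>
      using x y that unfolding Mgr_iff mpoly_add
      by (cases "k x \<mu> = \<zero>") (auto simp: k_coeff_closed)
    then show ?thesis
      using x y unfolding Mgr_iff by (simp add: k_add)
  qed
  have minus: "\<ominus>\<^bsub>M\<^esub> x \<in> Mgr g" if x: "x \<in> Mgr g" for x
  proof -
    have xM: "x \<in> carrier M"
      using x by (rule Mgr_carrier)
    have "k x \<mu> \<oplus> k (\<ominus>\<^bsub>M\<^esub> x) \<mu> = \<zero>" for \<mu>
      using k_add[OF xM M.M.a_inv_closed[OF xM]] M.M.r_neg[OF xM] k_zero
      by (metis mpoly_add mpoly_zero)
    then have "k (\<ominus>\<^bsub>M\<^esub> x) \<mu> = \<zero>" if "k x \<mu> = \<zero>" for \<mu>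
      using that k_coeff_closed[OF M.M.a_inv_closed[OF xM]] by (metis l_zero)
    then show ?thesis
      using x M.M.a_inv_closed[OF xM] unfolding Mgr_iff by blast
  qed
  show ?thesis
  proof (rule additive_subgroupI, rule M.M.add.subgroupI)
    show "Mgr g \<subseteq> carrier M"
      using Mgr_carrier by blast
    have "\<zero>\<^bsub>M\<^esub> \<in> Mgr g"
      by (subst Mgr_iff) (simp add: k_zero, simp add: mpoly_zero)
    then show "Mgr g \<noteq> {}"
      by blast
  qed (simp_all only: add minus flip: a_inv_def)
qed

lemma deg_add:
  assumes "\<alpha> \<in> exponents I" "\<beta> \<in> exponents I"
  shows "mdeg (\<alpha> + \<beta>) = mdeg \<alpha> \<otimes>\<^bsub>G\<^esub> mdeg \<beta>"
proof -
  have "Poly_Mapping.map int (\<alpha> + \<beta>) = Poly_Mapping.map int \<alpha> + Poly_Mapping.map int \<beta>"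
    by (rule poly_mapping_eqI) (simp add: lookup_add)
  moreover have "Poly_Mapping.map int \<mu> \<in> carrier (free_Abelian_group I)" if "\<mu> \<in> exponents I" for \<mu>
    using that by (auto simp: exponents_def free_Abelian_group_def in_keys_iff)
  ultimately show ?thesis
    using \<psi>_hom assms by (simp add: hom_def free_Abelian_group_def)
qed

lemma deg_closed: "\<mu> \<in> exponents I \<Longrightarrow> mdeg \<mu> \<in> carrier G"
  using \<psi>_hom by (auto simp: exponents_def free_Abelian_group_def in_keys_iff hom_def Pi_def subset_iff)

text \<open>Every component of a degree other than \<open>mdeg \<mu>\<close> has coefficient zero at
  \<open>\<mu>\<close>. Both existence and uniqueness of homogeneous decompositions follow from
  this.\<close>

lemma homogeneous_sum_coeff:
  assumes "\<And>g. g \<in> carrier G \<Longrightarrow> f g \<in> Mgr g"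
    and "\<And>g. g \<notin> carrier G \<Longrightarrow> f g = \<zero>\<^bsub>M\<^esub>"
    and "finite {g. f g \<noteq> \<zero>\<^bsub>M\<^esub>}"
  shows "k (\<Oplus>\<^bsub>M\<^esub>g\<in>{g. f g \<noteq> \<zero>\<^bsub>M\<^esub>}. f g) \<mu> = k (f (mdeg \<mu>)) \<mu>"
proof -
  let ?B = "{g. f g \<noteq> \<zero>\<^bsub>M\<^esub>}"
  have f: "f g \<in> carrier M" for g
    using assms(1,2)[of g] Mgr_carrier by (cases "g \<in> carrier G") auto
  have off: "k (f g) \<mu> = \<zero>" if "g \<noteq> mdeg \<mu>" for g
  proof (cases "g \<in> carrier G")
    case True
    then show ?thesis using assms(1)[OF True] that unfolding Mgr_iff by blast
  next
    case False
    then show ?thesis using assms(2) k_zero by (simp add: mpoly_zero)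
  qed
  have "k (\<Oplus>\<^bsub>M\<^esub>g\<in>?B. f g) \<mu> = (\<Oplus>g\<in>?B. k (f g) \<mu>)"
    using assms(3) f by (rule k_finsum_coeff)
  also have "\<dots> = k (f (mdeg \<mu>)) \<mu>"
  proof (cases "mdeg \<mu> \<in> ?B")
    case True
    then show ?thesis
      using assms(3) off k_coeff_closed[OF f] by (intro finsum_single) auto
  next
    case False
    then have "(\<Oplus>g\<in>?B. k (f g) \<mu>) = \<zero>"
      by (intro add.finprod_one_eqI off) auto
    then show ?thesis
      using False k_zero by (simp add: mpoly_zero)
  qed
  finally show ?thesis .
qed

lemma M_direct_sum:
  assumes x: "x \<in> carrier M"
  shows "\<exists>!f. (\<forall>g \<in> carrier G. f g \<in> Mgr g) \<and> (\<forall>g. g \<notin> carrier G \<longrightarrow> f g = \<zero>\<^bsub>M\<^esub>) \<and>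
    finite {g. f g \<noteq> \<zero>\<^bsub>M\<^esub>} \<and> x = (\<Oplus>\<^bsub>M\<^esub>g \<in> {g. f g \<noteq> \<zero>\<^bsub>M\<^esub>}. f g)"
proof -
  \<comment> \<open>The part of \<open>x\<close> of degree \<open>g\<close>, obtained by gathering
    its terms according to the degree of their exponents.\<close>
  define c where "c g = (\<lambda>\<mu>. if mdeg \<mu> = g then k x \<mu> else \<zero>)" for g
  have kx: "k x \<in> residues U" "k x \<in> carrier P"
    using k_closed[OF x] residues_closed by auto
  have c: "c g \<in> residues U" "c g \<in> carrier P" for g
    using mpoly_restrict_closed[OF kx(2), of "\<lambda>\<mu>. mdeg \<mu> = g"] kx(1)
    by (auto simp: c_def residues_def)
  have cM: "h (c g) \<in> carrier M" for g
    using c by (simp add: carrier_M)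
  have c0: "c g = \<zero>\<^bsub>P\<^esub>" if "\<And>\<mu>. k x \<mu> \<noteq> \<zero> \<Longrightarrow> mdeg \<mu> \<noteq> g" for g
    unfolding c_def mpoly_zero using that by (intro ext) metis
  show ?thesis
  proof (rule ex1I[of _ "\<lambda>g. h (c g)"], intro conjI ballI allI impI)
    show 1: "h (c g) \<in> Mgr g" for g
      unfolding Mgr_iff using cM c by (simp add: c_def)
    show 2: "h (c g) = \<zero>\<^bsub>M\<^esub>" if "g \<notin> carrier G" for g
    proof -
      have "c g = \<zero>\<^bsub>P\<^esub>"
        \<comment> \<open>All exponents occurring in \<open>x\<close> are supported in
          \<open>I\<close>, so their degrees lie in \<open>G\<close> and never equal
          \<open>g\<close>.\<close>
        using that deg_closed coeff_outside[OF kx(2)] by (intro c0) blast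
      then show ?thesis by (simp add: zero_M)
    qed
    have "{g. h (c g) \<noteq> \<zero>\<^bsub>M\<^esub>} \<subseteq> mdeg ` {\<mu>. k x \<mu> \<noteq> \<zero>}"
    proof
      fix g assume "g \<in> {g. h (c g) \<noteq> \<zero>\<^bsub>M\<^esub>}"
      then have "c g \<noteq> \<zero>\<^bsub>P\<^esub>"
        by (auto simp: zero_M)
      then show "g \<in> mdeg ` {\<mu>. k x \<mu> \<noteq> \<zero>}"
        using c0[of g] by blast
    qed
    then show 3: "finite {g. h (c g) \<noteq> \<zero>\<^bsub>M\<^esub>}"
      using finite_supp[OF kx(2)] finite_surj by blast
    let ?s = "\<Oplus>\<^bsub>M\<^esub>g \<in> {g. h (c g) \<noteq> \<zero>\<^bsub>M\<^esub>}. h (c g)"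
    have "k ?s \<mu> = k x \<mu>" for \<mu>
      using homogeneous_sum_coeff[OF 1 2 3, of \<mu>] c by (simp add: c_def)
    then have "k ?s = k x"
      by (rule ext)
    moreover have "?s \<in> carrier M"
      using cM by (intro M.finsum_closed) auto
    ultimately show "x = ?s"
      using h_k x by metis
  next
    fix f
    assume f: "(\<forall>g \<in> carrier G. f g \<in> Mgr g) \<and> (\<forall>g. g \<notin> carrier G \<longrightarrow> f g = \<zero>\<^bsub>M\<^esub>) \<and>
      finite {g. f g \<noteq> \<zero>\<^bsub>M\<^esub>} \<and> x = (\<Oplus>\<^bsub>M\<^esub>g \<in> {g. f g \<noteq> \<zero>\<^bsub>M\<^esub>}. f g)"
    have kf: "k x \<mu> = k (f (mdeg \<mu>)) \<mu>" for \<mu>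
      using homogeneous_sum_coeff[of f \<mu>] f by simp
    show "f = (\<lambda>g. h (c g))"
    proof
      fix g
      show "f g = h (c g)"
      proof (cases "g \<in> carrier G")
        case True
        then have fg: "f g \<in> Mgr g"
          using f by blast
        \<comment> \<open>For \<open>mdeg \<mu> = g\<close> this is \<open>kf\<close>; otherwise
          both sides vanish, the left one because \<open>f g\<close> is homogeneous of degree
          \<open>g\<close>.\<close>
        have "k (f g) \<mu> = c g \<mu>" for \<mu>
          using fg kf[of \<mu>] unfolding Mgr_iff c_def by auto
        then have "k (f g) = c g" by (rule ext)
        then show ?thesis
          using h_k[OF Mgr_carrier[OF fg]] by simp
      next
        case False
        then have "c g = \<zero>\<^bsub>P\<^esub>"
          using deg_closed coeff_outside[OF kx(2)] by (intro c0) blast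
        then show ?thesis
          using f False by (simp add: zero_M)
      qed
    qed
  qed
qed

text \<open>Each exponent of the product is a sum of exponents of degrees \<open>a\<close> and
  \<open>b\<close>, and truncation merely deletes terms.\<close>

lemma M_smult_degree:
  assumes "r \<in> mpoly_grading A I \<psi> a" "x \<in> Mgr b"
  shows "r \<odot>\<^bsub>M\<^esub> x \<in> Mgr (a \<otimes>\<^bsub>G\<^esub> b)"
proof -
  obtain p where p: "p \<in> residues U" "p \<in> mpoly_grading A I \<psi> b" "x = h p"
    using assms(2) by auto
  have r: "r \<in> carrier P" and pc: "p \<in> carrier P"
    using assms(1) p(2) by (simp_all add: mpoly_grading_def)
  have t: "trunc U (r \<otimes>\<^bsub>P\<^esub> p) \<in> residues U"
    using r pc by (intro trunc_residues) simp
  have "mdeg \<mu> = a \<otimes>\<^bsub>G\<^esub> b" if nz: "trunc U (r \<otimes>\<^bsub>P\<^esub> p) \<mu> \<noteq> \<zero>" for \<mu>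
  proof -
    have "(r \<otimes>\<^bsub>P\<^esub> p) \<mu> \<noteq> \<zero>"
      using nz by (simp add: trunc_def split: if_splits)
    then obtain \<alpha> \<beta> where "\<mu> = \<alpha> + \<beta>" and nz': "r \<alpha> \<noteq> \<zero>" "p \<beta> \<noteq> \<zero>"
      by (rule mpoly_mult_supp[OF r pc])
    moreover have "\<alpha> \<in> exponents I" "\<beta> \<in> exponents I"
      using nz' coeff_outside r pc by blast+
    moreover have "mdeg \<alpha> = a" "mdeg \<beta> = b"
      using nz' assms(1) p(2) by (simp_all add: mpoly_grading_def)
    ultimately show ?thesis
      by (simp add: deg_add)
  qed
  then show ?thesis
    using t residues_closed[OF t] unfolding Mgr_iff p(3) smult_M[OF p(1)] by (simp add: carrier_M)
qed

lemma M_graded: "graded_module G P (mpoly_grading A I \<psi>) M Mgr"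
proof (intro graded_module.intro graded_module_axioms.intro M_module)
  show "additive_subgroup (Mgr g) M" for g
    by (rule Mgr_subgroup)
  show "r \<odot>\<^bsub>M\<^esub> x \<in> Mgr (a \<otimes>\<^bsub>G\<^esub> b)" if "r \<in> mpoly_grading A I \<psi> a" "x \<in> Mgr b" for a b r x
    using that by (rule M_smult_degree)
qed (rule M_direct_sum)

text \<open>The first power of the ideal already annihilates its quotient.\<close>

lemma M_torsion: "torsion P (supp_ideal U) M = carrier M"
proof
  show "carrier M \<subseteq> torsion P (supp_ideal U) M"
  proof
    fix x assume x: "x \<in> carrier M"
    have "r \<odot>\<^bsub>M\<^esub> x = \<zero>\<^bsub>M\<^esub>" if "r \<in> supp_ideal U" for r
    proof -
      have "r \<otimes>\<^bsub>P\<^esub> k x \<in> supp_ideal U"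
        using ideal.I_r_closed[OF supp_ideal_is_ideal that] k_closed[OF x] residues_closed by blast
      then have "trunc U (r \<otimes>\<^bsub>P\<^esub> k x) = \<zero>\<^bsub>P\<^esub>"
        using trunc_eq_zero_iff supp_ideal_closed by blast
      then show ?thesis
        using smult_M[OF k_closed[OF x], of r] h_k[OF x] by (simp add: zero_M)
    qed
    then have "x \<in> annihilated M (supp_ideal U [^]\<^bsub>ideals_set P\<^esub> Suc 0)"
      unfolding P.ideal_power_1[OF supp_ideal_is_ideal] annihilated_def using x by blast
    then show "x \<in> torsion P (supp_ideal U) M"
      unfolding torsion_def by blast
  qed
qed (auto simp: torsion_def annihilated_def)

text \<open>The class of one has the ideal itself as annihilator. If that class is torsion for
  \<open>K\<close>, some power of \<open>K\<close> lies in the ideal.\<close>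

lemma subset_radical_if_torsion:
  assumes "ideal K P"
    and "torsion P K M = torsion P (supp_ideal U) M"
  shows "K \<subseteq> radical P (supp_ideal U)"
proof -
  \<comment> \<open>One has to be truncated, since it need not be a residue when
    \<open>0 \<in> U\<close>.\<close>
  let ?e = "trunc U \<one>\<^bsub>P\<^esub>"
  have e: "?e \<in> residues U"
    by (intro trunc_residues) simp
  then have "h ?e \<in> torsion P K M"
    unfolding assms(2) M_torsion by (simp add: carrier_M)
  then obtain n :: nat where n: "\<And>r. r \<in> K [^]\<^bsub>ideals_set P\<^esub> n \<Longrightarrow> r \<odot>\<^bsub>M\<^esub> h ?e = \<zero>\<^bsub>M\<^esub>"
    by (auto simp: torsion_def annihilated_def)
  have "r \<in> supp_ideal U" if r: "r \<in> K [^]\<^bsub>ideals_set P\<^esub> n" for r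
  proof -
    have rc: "r \<in> carrier P"
      using ideal.Icarr[OF P.ideal_power_is_ideal[OF assms(1)] r] .
    \<comment> \<open>By \<open>trunc_mult_trunc\<close> the action of \<open>r\<close> on the class
      of one gives the class of \<open>r\<close>.\<close>
    have "h (trunc U r) = h \<zero>\<^bsub>P\<^esub>"
      using n[OF r] trunc_mult_trunc[OF rc P.one_closed] rc by (simp add: smult_M[OF e] zero_M)
    then have "trunc U r = \<zero>\<^bsub>P\<^esub>"
      using inj_onD[OF h_inj] residues_closed trunc_residues[OF rc] P.zero_closed by blast
    then show ?thesis
      using trunc_eq_zero_iff[OF rc] by simp
  qed
  then show ?thesis
    using P.nat_pow_in_ideal_power[OF _ assms(1), of _ n] ideal.Icarr[OF assms(1)]
    unfolding radical_def by blast
qed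

end

section \<open>The zero ring and the comparison of arbitrary monomial ideals\<close>

context mpoly
begin

lemma monomial_ideal_iff:
  "monomial_ideal A I J \<longleftrightarrow> (\<exists>S \<subseteq> exponents I. J = supp_ideal (upset S))"
  using genideal_monoms by (auto simp: monomial_ideal_def)

lemma zero_ring_ideal:
  assumes "\<one> = \<zero>" "ideal J P"
  shows "J = {\<zero>\<^bsub>P\<^esub>}"
proof -
  have "carrier A = {\<zero>}"
    using assms(1) one_zeroD by simp
  then have "carrier P \<subseteq> {\<zero>\<^bsub>P\<^esub>}"
    by (auto simp: mpoly_carrier_iff mpoly_zero)
  then show ?thesis
    using ideal.Icarr[OF assms(2)] additive_subgroup.zero_closed[OF ideal.axioms(1)[OF assms(2)]] by blast
qed

text \<open>All monomials are zero here, so the floor is zero whatever exponents the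
  \<open>THE\<close> in \<open>min_exponents\<close> selects.\<close>

lemma zero_ring_floor:
  assumes "\<one> = \<zero>" "ideal J P"
  shows "floor_ideal A I J = {\<zero>\<^bsub>P\<^esub>}"
proof -
  have "mpoly_monom A \<mu> = \<zero>\<^bsub>P\<^esub>" for \<mu> :: "'i \<Rightarrow>\<^sub>0 nat"
    using assms(1) by (auto simp: mpoly_monom_def mpoly_zero)
  then show ?thesis
    unfolding floor_ideal_def
    by (intro zero_ring_ideal[OF assms(1)] P.genideal_ideal) auto
qed

lemma monomial_ideal_is_ideal: "monomial_ideal A I J \<Longrightarrow> ideal J P"
  using supp_ideal_is_ideal by (auto simp: monomial_ideal_iff)

lemma torsion_floor:
  assumes "monomial_ideal A I J" "finite_type_ideal P J"
  shows "torsion P J N = torsion P (floor_ideal A I J) N"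
proof (cases "\<one> = \<zero>")
  case True
  then show ?thesis
    using zero_ring_floor zero_ring_ideal monomial_ideal_is_ideal[OF assms(1)] by simp
next
  case False
  then obtain S where S: "S \<subseteq> exponents I" "J = supp_ideal (upset S)"
    using assms(1) by (auto simp: monomial_ideal_iff)
  show ?thesis
    using floor_finite_type[OF _ S(1) False] radical_floor[OF _ S(1) False] assms(2)
    unfolding S(2) by (intro P.torsion_cong_radical) auto
qed

text \<open>An ideal and its floor share their radical, which gives one direction; the other applies
  \<open>floor_mono_radical\<close> both ways.\<close>

lemma floor_eq_iff_radical_eq:
  assumes "monomial_ideal A I J" "finite_type_ideal P J"
    and "monomial_ideal A I K" "finite_type_ideal P K"
  shows "floor_ideal A I J = floor_ideal A I K \<longleftrightarrow> radical P J = radical P K"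
proof (cases "\<one> = \<zero>")
  case True
  then have "J = {\<zero>\<^bsub>P\<^esub>}" "K = {\<zero>\<^bsub>P\<^esub>}"
    using zero_ring_ideal assms(1,3)[THEN monomial_ideal_is_ideal] by blast+
  then show ?thesis by simp
next
  case False
  then obtain S T where S: "S \<subseteq> exponents I" "J = supp_ideal (upset S)"
    and T: "T \<subseteq> exponents I" "K = supp_ideal (upset T)"
    using assms(1,3) by (auto simp: monomial_ideal_iff)
  show ?thesis
  proof
    assume "floor_ideal A I J = floor_ideal A I K"
    then show "radical P J = radical P K"
      using radical_floor[OF _ S(1) False] radical_floor[OF _ T(1) False] assms(2,4)
      unfolding S(2) T(2) by simp
  next
    assume eq: "radical P J = radical P K"
    have "J \<subseteq> radical P J" "K \<subseteq> radical P K"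
      using assms(1,3) monomial_ideal_is_ideal P.ideal_subset_radical by blast+
    then show "floor_ideal A I J = floor_ideal A I K"
      using floor_mono_radical[OF False] eq unfolding S(2) T(2) by (intro subset_antisym) auto
  qed
qed

lemma torsion_eq_imp_radical_eq:
  assumes "comm_group G" "\<psi> \<in> hom (free_Abelian_group I) G"
    and "carrier P \<lesssim> (UNIV :: 'm set)"
    and J: "monomial_ideal A I J" "finite_type_ideal P J"
    and K: "monomial_ideal A I K" "finite_type_ideal P K"
    and eq: "torsion_functors_eq TYPE('m) G P (mpoly_grading A I \<psi>) J K"
  shows "radical P J = radical P K"
proof -
  obtain h :: "(('i \<Rightarrow>\<^sub>0 nat) \<Rightarrow> 'a) \<Rightarrow> 'm" where h: "inj_on h (carrier P)"
    using assms(3) by (auto simp: lepoll_def)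
  \<comment> \<open>Stated for two ideals because each of \<open>J\<close> and \<open>K\<close>
    serves once as the ideal \<open>L\<close> whose quotient is the test module.\<close>
  have sub: "L' \<subseteq> radical P L"
    if L: "monomial_ideal A I L" "ideal L' P"
      and tors: "\<And>(M :: (('i \<Rightarrow>\<^sub>0 nat) \<Rightarrow> 'a, 'm) module) Mgr.
        graded_module G P (mpoly_grading A I \<psi>) M Mgr \<Longrightarrow> torsion P L' M = torsion P L M" for L L'
  proof -
    obtain S where S: "L = supp_ideal (upset S)"
      using L(1) by (auto simp: monomial_ideal_iff)
    interpret Q: mpoly_quotient A I G \<psi> h S
      by (rule mpoly_quotient.intro[OF mpoly_axioms assms(1) mpoly_quotient_axioms.intro[OF assms(2) h]])
    show ?thesis
      unfolding S using Q.subset_radical_if_torsion[OF L(2)] tors[OF Q.M_graded] unfolding S by blast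
  qed
  note ideals = monomial_ideal_is_ideal[OF J(1)] monomial_ideal_is_ideal[OF K(1)]
  have "K \<subseteq> radical P J"
    using eq by (intro sub J(1) ideals(2)) (auto simp: torsion_functors_eq_def)
  moreover have "J \<subseteq> radical P K"
    using eq by (intro sub K(1) ideals(1)) (auto simp: torsion_functors_eq_def)
  ultimately show ?thesis
    using P.radical_mono_radical[OF J(2) ideals(2)] P.radical_mono_radical[OF K(2) ideals(1)] by blast
qed

end

text \<open>The cardinality bound guards only the equivalence with (i): over a one-element type
  \<open>'m\<close> every module is zero and any two torsion functors agree. The bound is met, for
  example, when \<open>'m\<close> is the type of the polynomials.\<close>

theorem mainTheorem1:
  fixes A :: "('a, 'k) ring_scheme"
    and I :: "'i set"
    and G :: "('g, 'h) monoid_scheme"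
    and \<psi> :: "('i \<Rightarrow>\<^sub>0 int) \<Rightarrow> 'g"
  assumes "cring A"
    and "comm_group G"
    and "\<psi> \<in> epi (free_Abelian_group I) G"
  shows
    "(\<forall>\<aa>. monomial_ideal A I \<aa> \<and> finite_type_ideal (mpoly_ring A I) \<aa> \<longrightarrow>
        torsion_functors_eq TYPE('m) G (mpoly_ring A I) (mpoly_grading A I \<psi>)
          \<aa> (floor_ideal A I \<aa>))
     \<and>
     (\<forall>\<aa> \<bb>. monomial_ideal A I \<aa> \<and> finite_type_ideal (mpoly_ring A I) \<aa> \<and>
            monomial_ideal A I \<bb> \<and> finite_type_ideal (mpoly_ring A I) \<bb> \<longrightarrow>
        (carrier (mpoly_ring A I) \<lesssim> (UNIV :: 'm set) \<longrightarrow>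
           (torsion_functors_eq TYPE('m) G (mpoly_ring A I) (mpoly_grading A I \<psi>) \<aa> \<bb> \<longleftrightarrow>
            floor_ideal A I \<aa> = floor_ideal A I \<bb>)) \<and>
        (floor_ideal A I \<aa> = floor_ideal A I \<bb> \<longleftrightarrow>
         radical (mpoly_ring A I) \<aa> = radical (mpoly_ring A I) \<bb>))"
proof -
  interpret mpoly A I
    by (intro mpoly.intro assms(1))
  have hom: "\<psi> \<in> hom (free_Abelian_group I) G"
    using assms(3) by (simp add: epi_def)
  have floor: "torsion_functors_eq TYPE('m) G P (mpoly_grading A I \<psi>) \<aa> (floor_ideal A I \<aa>)"
    if "monomial_ideal A I \<aa>" "finite_type_ideal P \<aa>" for \<aa>
    unfolding torsion_functors_eq_def by (intro allI impI torsion_floor that)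
  have equiv: "torsion_functors_eq TYPE('m) G P (mpoly_grading A I \<psi>) \<aa> \<bb> \<longleftrightarrow>
      floor_ideal A I \<aa> = floor_ideal A I \<bb>"
    if ab: "monomial_ideal A I \<aa>" "finite_type_ideal P \<aa>"
      "monomial_ideal A I \<bb>" "finite_type_ideal P \<bb>"
      and m: "carrier P \<lesssim> (UNIV :: 'm set)" for \<aa> \<bb>
  proof
    assume "torsion_functors_eq TYPE('m) G P (mpoly_grading A I \<psi>) \<aa> \<bb>"
    from torsion_eq_imp_radical_eq[OF assms(2) hom m ab this]
    show "floor_ideal A I \<aa> = floor_ideal A I \<bb>"
      using floor_eq_iff_radical_eq[OF ab] by blast
  next
    assume eq: "floor_ideal A I \<aa> = floor_ideal A I \<bb>"
    have "torsion P \<aa> N = torsion P \<bb> N" for N :: "(('i \<Rightarrow>\<^sub>0 nat) \<Rightarrow> 'a, 'm) module"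
      using torsion_floor[OF ab(1,2), of N] torsion_floor[OF ab(3,4), of N] eq by simp
    then show "torsion_functors_eq TYPE('m) G P (mpoly_grading A I \<psi>) \<aa> \<bb>"
      by (simp add: torsion_functors_eq_def)
  qed
  show ?thesis
    by (intro conjI allI impI floor equiv floor_eq_iff_radical_eq) simp_all
qed

end
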